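(* Let $\rho>0$, $w\sim\mathcal{N}(0,\rho^2)$, $m_t:=\mathbb{E}\,w^t$, and for $T\in\mathbb{N}^*$ let $B_T:=(m_{i+j})_{0\le i,j\le T}$ with eigenvalues $\lambda_T(B_T)\le\cdots\le\lambda_0(B_T)$, $\lambda_{\max}(B_T)=\lambda_0(B_T)$, $\lambda_{\min}(B_T)=\lambda_T(B_T)$. Then \[ \frac{\lambda_{\max}(B_T)}{\sum_{i=0}^T\lambda_i(B_T)}\xrightarrow[T\to\infty]{}1, \] and, as $T\to\infty$, \[ \lambda_{\max}(B_T)\simeq\sqrt2\left(\frac{2\rho^2T}{e}\right)^T,\qquad \lambda_{\min}(B_T)\simeq\frac{2^{5/2}\pi T^{1/4}}{\rho^{3/2}}\exp\left(\frac{1}{2\rho^2}-\frac{2\sqrt T}{\rho}\right). \]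
   Context: For positive sequences, $x_T\simeq y_T$ as $T\to\infty$ means $x_T/y_T\to1$. *)

theory Defs
  imports "HOL-Probability.Probability" "Jordan_Normal_Form.Char_Poly"
    "HOL-Computational_Algebra.Polynomial"
begin

definition gauss_moment :: "real \<Rightarrow> nat \<Rightarrow> real" where
  "gauss_moment \<rho> t = integral\<^sup>L lborel (\<lambda>x. normal_density 0 \<rho> x * x ^ t)"

definition hankel_B :: "real \<Rightarrow> nat \<Rightarrow> real mat" where
  "hankel_B \<rho> T = mat (T + 1) (T + 1) (\<lambda>(i, j). gauss_moment \<rho> (i + j))"

text \<open>Multiset of eigenvalues of B_T (roots of the characteristic polynomial, with
  algebraic multiplicity; B_T is real symmetric, so all of them are real).\<close>
definition eigs_B :: "real \<Rightarrow> nat \<Rightarrow> real multiset" where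
  "eigs_B \<rho> T = proots (char_poly (hankel_B \<rho> T))"

definition lambda_max :: "real \<Rightarrow> nat \<Rightarrow> real" where
  "lambda_max \<rho> T = Max (set_mset (eigs_B \<rho> T))"

definition lambda_min :: "real \<Rightarrow> nat \<Rightarrow> real" where
  "lambda_min \<rho> T = Min (set_mset (eigs_B \<rho> T))"

definition lambda_sum :: "real \<Rightarrow> nat \<Rightarrow> real" where
  "lambda_sum \<rho> T = sum_mset (eigs_B \<rho> T)"

end

theory Submission
  imports Defs "Jordan_Normal_Form.Schur_Decomposition" "HOL-Real_Asymp.Real_Asymp"
begin

text \<open>
  Let \<open>C\<close> be the inverse of \<open>B_T\<close>. Then \<open>C = L^T L\<close>, where the rows of \<open>L\<close> are the coefficients of the
  orthonormal Hermite polynomials, and \<open>1 / \<lambda>_min\<close> is the largest eigenvalue of \<open>C\<close>. Since \<open>C\<close> splits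
  into an even and an odd block, this eigenvalue is at most the larger of the two block traces; it is also at least
  \<open>tr C\<^sup>2 / tr C\<close>. The two bounds agree asymptotically because each block is nearly of rank one:
  with \<open>x = sqrt T / \<rho>\<close>, the entries with indices close to \<open>x\<close> satisfy
  \<open>\<bar>C_jk\<bar> \<sim> g (x^j / j!) (x^k / k!)\<close> for a constant \<open>g\<close>, and the other diagonal entries are negligible.
  Finally \<open>(x^j / j!)\<^sup>2 = (binom(2j, j) / 4^j) (2x)^(2j) / (2j)!\<close>, so the block traces follow from Wallis' product and the
  series of \<open>cosh 2x \<plusminus> cos 2x\<close>.

  The largest eigenvalue of \<open>B_T\<close> lies between \<open>tr B\<^sup>2 / tr B\<close> and \<open>tr B\<close>, both of which are asymptotic to the
  last diagonal entry.
\<close>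

section \<open>Eigenvalues of real symmetric matrices\<close>

text \<open>Odd moments vanish, so C falls into two parity blocks, and their traces have the same
  leading term. The full trace would thus overestimate the top eigenvalue by a factor 2, while in tr
  C^2 / tr C this factor occurs above and below and cancels. Neither bound needs a trial vector.

  The entries can be estimated from both sides because nothing cancels: for j + k even, the signs of
  the two Hermite coefficients multiply to a sign independent of the degree n, so |C_jk| is a sum of
  nonnegative weights.

  The scale x comes from T^j / (\<rho>^j j!)^2 = (x^j / j!)^2, whose mass sits at j near x. There n!
  / (n - j)! is about n^j exp(-j^2 / (2n)), the rows n near T dominate, and j^2 / T tends to 1 /
  \<rho>^2: this is the origin of exp(1 / (2 \<rho>^2)). The bounds have to be uniform over a window
  of indices j, hence explicit inequalities come before any limit.

  For B, consecutive diagonal entries have quotient \<rho>^2 (2T + 1), which is unbounded; this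
  makes the last one dominate the trace.\<close>

definition trace_mat :: "'a::comm_ring_1 mat \<Rightarrow> 'a" where
  "trace_mat A = (\<Sum>i<dim_row A. A $$ (i, i))"

lemma trace_mat_mult_comm:
  assumes "A \<in> carrier_mat n m" "B \<in> carrier_mat m n"
  shows "trace_mat (A * B) = trace_mat (B * A)"
proof -
  have "trace_mat (A * B) = (\<Sum>i<n. \<Sum>j<m. A $$ (i, j) * B $$ (j, i))"
    using assms by (auto simp: trace_mat_def scalar_prod_def lessThan_atLeast0 intro!: sum.cong)
  also have "\<dots> = (\<Sum>j<m. \<Sum>i<n. B $$ (j, i) * A $$ (i, j))"
    by (subst sum.swap) (simp add: mult.commute)
  also have "\<dots> = trace_mat (B * A)"
    using assms by (auto simp: trace_mat_def scalar_prod_def lessThan_atLeast0 intro!: sum.cong)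
  finally show ?thesis .
qed

lemma trace_mat_similar:
  assumes "similar_mat_wit A B P Q" and A: "A \<in> carrier_mat n n"
  shows "trace_mat A = trace_mat B"
proof -
  note D = similar_mat_witD2[OF A assms(1)]
  have "trace_mat A = trace_mat (P * (B * Q))"
    using D by (simp add: assoc_mult_mat)
  also have "\<dots> = trace_mat (B * Q * P)"
    by (rule trace_mat_mult_comm) (use D in auto)
  also have "B * Q * P = B * (Q * P)" by (rule assoc_mult_mat) (use D in auto)
  also have "\<dots> = B" using D by auto
  finally show ?thesis .
qed

lemma trace_mat_sum_list_diag: "A \<in> carrier_mat n n \<Longrightarrow> trace_mat A = sum_list (diag_mat A)"
  unfolding trace_mat_def diag_mat_def
  by (simp add: sum_list_sum_nth lessThan_atLeast0)

text \<open>The Schur form is triangular with \<open>es\<close> on its diagonal, its square is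
  similar to \<open>A * A\<close>, and traces are invariant under similarity.\<close>

lemma sum_list_char_poly_roots:
  fixes A :: "real mat"
  assumes A: "A \<in> carrier_mat n n" and c: "char_poly A = (\<Prod>e\<leftarrow>es. [:- e, 1:])"
  shows "trace_mat A = sum_list es" "trace_mat (A * A) = (\<Sum>e\<leftarrow>es. e\<^sup>2)"
proof -
  obtain B P Q where s: "schur_decomposition A es = (B, P, Q)" by (cases "schur_decomposition A es") auto
  from schur_decomposition[OF A c s]
  have sim: "similar_mat_wit A B P Q" and ut: "upper_triangular B" and d: "diag_mat B = es" by auto
  note D = similar_mat_witD2[OF A sim]
  show "trace_mat A = sum_list es"
    using trace_mat_similar[OF sim A] trace_mat_sum_list_diag[of B n] D d by simp
  have sim2: "similar_mat_wit (A * A) (B * B) P Q"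
  proof (rule similar_mat_witI)
    show "P * Q = 1\<^sub>m n" "Q * P = 1\<^sub>m n" using D by auto
    have "Q * (P * (B * Q)) = (Q * P) * (B * Q)"
      by (rule assoc_mult_mat[symmetric]) (use D in auto)
    then have "Q * (P * (B * Q)) = B * Q" using D by simp
    then show "A * A = P * (B * B) * Q"
      using D by (simp add: assoc_mult_mat[of _ n n _ n _ n])
  qed (use A D in auto)
  have "(B * B) $$ (i, i) = (B $$ (i, i))\<^sup>2" if "i < n" for i
  proof -
    have "(B * B) $$ (i, i) = (\<Sum>j<n. B $$ (i, j) * B $$ (j, i))"
      using that D by (auto simp: scalar_prod_def lessThan_atLeast0)
    \<comment> \<open>For j different from i, one of the positions (i, j) and (j, i) lies below the
      diagonal.\<close>
    also have "\<dots> = (\<Sum>j\<in>{i}. B $$ (i, j) * B $$ (j, i))"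
    proof (rule sum.mono_neutral_right)
      show "\<forall>j\<in>{..<n} - {i}. B $$ (i, j) * B $$ (j, i) = 0"
      proof
        fix j assume j: "j \<in> {..<n} - {i}"
        then have "j < i \<or> i < j" by auto
        then show "B $$ (i, j) * B $$ (j, i) = 0"
          using ut j that D by (auto simp: upper_triangular_def)
      qed
    qed (use that in auto)
    finally show ?thesis by (simp add: power2_eq_square)
  qed
  then have "trace_mat (B * B) = (\<Sum>i<n. (B $$ (i, i))\<^sup>2)"
    using D by (auto simp: trace_mat_def)
  also have "\<dots> = (\<Sum>e\<leftarrow>diag_mat B. e\<^sup>2)"
    using D unfolding diag_mat_def by (simp add: sum_list_sum_nth lessThan_atLeast0)
  finally show "trace_mat (A * A) = (\<Sum>e\<leftarrow>es. e\<^sup>2)"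
    using trace_mat_similar[OF sim2, of n] A d by simp
qed

text \<open>For an eigenvector v, the Hermitian form S of A at v equals its own conjugate by
  symmetry, and also equals a times the positive number N, the squared norm of v.\<close>

lemma real_symmetric_complex_eigenvalue_real:
  fixes A :: "real mat"
  assumes A: "A \<in> carrier_mat n n" and sym: "\<And>i j. i < n \<Longrightarrow> j < n \<Longrightarrow> A $$ (i, j) = A $$ (j, i)"
    and ev: "eigenvalue (map_mat complex_of_real A) a"
  shows "a \<in> \<real>"
proof -
  let ?A = "map_mat complex_of_real A"
  from ev obtain v where v: "v \<in> carrier_vec n" "v \<noteq> 0\<^sub>v n" "?A *\<^sub>v v = a \<cdot>\<^sub>v v"
    using A by (auto simp: eigenvalue_def eigenvector_def)
  have comp: "(\<Sum>j<n. of_real (A $$ (i, j)) * v $ j) = a * v $ i" if "i < n" for i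
  proof -
    have "(?A *\<^sub>v v) $ i = (\<Sum>j<n. of_real (A $$ (i, j)) * v $ j)"
      using that A v(1) by (auto simp: scalar_prod_def lessThan_atLeast0)
    then show ?thesis using v that by simp
  qed
  define S where "S = (\<Sum>i<n. cnj (v $ i) * (\<Sum>j<n. of_real (A $$ (i, j)) * v $ j))"
  define N where "N = (\<Sum>i<n. (cmod (v $ i))\<^sup>2)"
  have "S = (\<Sum>i<n. a * (v $ i * cnj (v $ i)))"
    unfolding S_def by (intro sum.cong refl) (simp add: comp)
  also have "\<dots> = a * of_real N"
    by (simp only: N_def of_real_sum complex_norm_square sum_distrib_left)
  finally have S: "S = a * of_real N" .
  have "cnj S = (\<Sum>i<n. \<Sum>j<n. v $ i * of_real (A $$ (i, j)) * cnj (v $ j))"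
    by (simp add: S_def sum_distrib_left algebra_simps)
  also have "\<dots> = (\<Sum>j<n. \<Sum>i<n. v $ i * of_real (A $$ (i, j)) * cnj (v $ j))"
    by (rule sum.swap)
  also have "\<dots> = S"
    unfolding S_def by (intro sum.cong refl) (auto simp: sum_distrib_left sym intro!: sum.cong)
  finally have "S \<in> \<real>" by (simp add: Reals_cnj_iff)
  moreover have "N \<noteq> 0"
  proof
    assume "N = 0"
    then have "\<forall>i<n. v $ i = 0" unfolding N_def by (subst (asm) sum_nonneg_eq_0_iff) auto
    then show False using v by (auto simp: vec_eq_iff)
  qed
  ultimately show ?thesis
    using S by (metis Reals_divide Reals_of_real nonzero_mult_div_cancel_right of_real_eq_0_iff)
qed

text \<open>The factorization exists over the complex numbers; as all roots are real, it is the
  image of a real one under an injective homomorphism.\<close>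

lemma real_symmetric_char_poly_splits:
  fixes A :: "real mat"
  assumes A: "A \<in> carrier_mat n n" and sym: "\<And>i j. i < n \<Longrightarrow> j < n \<Longrightarrow> A $$ (i, j) = A $$ (j, i)"
  obtains es where "char_poly A = (\<Prod>e\<leftarrow>es. [:- e, 1:])" "length es = n"
proof -
  let ?A = "map_mat complex_of_real A"
  have A': "?A \<in> carrier_mat n n" using A by simp
  obtain as where as: "char_poly ?A = (\<Prod>a\<leftarrow>as. [:- a, 1:])" "length as = n"
    using char_poly_factorized[OF A'] by auto
  have "a \<in> \<real>" if "a \<in> set as" for a
  proof (rule real_symmetric_complex_eigenvalue_real[OF A sym])
    show "eigenvalue ?A a"
      using that by (simp add: eigenvalue_root_char_poly[OF A'] as poly_prod_list prod_list_zero_iff o_def image_iff)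
  qed auto
  then have as_eq: "as = map complex_of_real (map Re as)"
    by (induction as) (auto simp: complex_is_Real_iff complex_eq_iff)
  interpret of_real_poly_hom: map_poly_inj_idom_hom complex_of_real ..
  have "map_poly complex_of_real (char_poly A) = char_poly ?A"
    by (rule of_real_hom.char_poly_hom[OF A, symmetric])
  also have "\<dots> = (\<Prod>a\<leftarrow>map Re as. map_poly complex_of_real [:- a, 1:])"
    unfolding as by (subst as_eq) (simp add: o_def)
  also have "\<dots> = map_poly complex_of_real (\<Prod>a\<leftarrow>map Re as. [:- a, 1:])"
    by (simp add: of_real_poly_hom.hom_prod_list o_def)
  finally have "char_poly A = (\<Prod>a\<leftarrow>map Re as. [:- a, 1:])"
    by (rule of_real_poly_hom.injectivity)
  then show ?thesis using that as(2) by (metis length_map)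
qed

text \<open>Connects the multiset \<open>eigs_B\<close> with the list of roots on which the trace
  identities operate.\<close>

lemma proots_prod_list_linear:
  fixes es :: "real list"
  shows "proots (\<Prod>e\<leftarrow>es. [:- e, 1:]) = mset es"
proof -
  have "proots [:- e, 1:] = {#e#}" for e :: real
    by (rule multiset_eqI) (use order_linear_power'[of e 1] in \<open>auto simp: order_power_n_n[of _ 1, simplified] order_0I\<close>)
  moreover have "(\<Prod>e\<leftarrow>es. [:- e, 1:]) \<noteq> 0" for es :: "real list"
    by (auto simp: prod_list_zero_iff)
  ultimately show ?thesis
    by (induction es) (auto simp: proots_mult simp del: mult_pCons_left)
qed

text \<open>Each nonnegative root satisfies e^2 \<le> Max e; summing over the roots turns both sides
  into traces.\<close>

lemma max_root_ge_trace_quotient: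
  fixes A :: "real mat"
  assumes A: "A \<in> carrier_mat n n" and c: "char_poly A = (\<Prod>e\<leftarrow>es. [:- e, 1:])"
    and nonneg: "\<And>e. e \<in> set es \<Longrightarrow> e \<ge> 0" and "es \<noteq> []"
  shows "trace_mat (A * A) \<le> Max (set es) * trace_mat A"
proof -
  have "(\<Sum>e\<leftarrow>es. e\<^sup>2) \<le> (\<Sum>e\<leftarrow>es. Max (set es) * e)"
    using nonneg by (intro sum_list_mono) (auto simp: power2_eq_square intro!: mult_right_mono)
  then show ?thesis
    by (simp add: sum_list_char_poly_roots[OF A c] sum_list_const_mult)
qed

lemma trace_mat_square_symmetric:
  fixes A :: "real mat"
  assumes A: "A \<in> carrier_mat n n" and sym: "\<And>i j. i < n \<Longrightarrow> j < n \<Longrightarrow> A $$ (i, j) = A $$ (j, i)"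
  shows "trace_mat (A * A) = (\<Sum>i<n. \<Sum>j<n. (A $$ (i, j))\<^sup>2)"
proof -
  have "trace_mat (A * A) = (\<Sum>i<n. \<Sum>j<n. A $$ (i, j) * A $$ (j, i))"
    using A by (auto simp: trace_mat_def scalar_prod_def lessThan_atLeast0 intro!: sum.cong)
  also have "\<dots> = (\<Sum>i<n. \<Sum>j<n. (A $$ (i, j))\<^sup>2)"
    using sym by (intro sum.cong) (auto simp: power2_eq_square)
  finally show ?thesis .
qed

section \<open>Gaussian moments and Hermite polynomials\<close>

lemma gauss_moment_even:
  assumes "\<rho> > 0" shows "gauss_moment \<rho> (2 * k) = \<rho> ^ (2 * k) * fact (2 * k) / (2 ^ k * fact k)"
  using integral_normal_moment_even[of \<rho> 0 k] assms
  by (simp add: gauss_moment_def power_divide field_simps flip: power_mult)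

lemma gauss_moment_odd:
  assumes "\<rho> > 0" "odd k" shows "gauss_moment \<rho> k = 0"
  using integral_normal_moment_odd[of \<rho> 0 "k div 2"] assms
  by (auto simp: gauss_moment_def elim!: oddE)

lemma gauss_moment_rec:
  assumes "\<rho> > 0"
  shows "gauss_moment \<rho> (Suc (Suc t)) = \<rho>\<^sup>2 * real (Suc t) * gauss_moment \<rho> t"
proof (cases "even t")
  case True
  then obtain k where k: "t = 2 * k" by blast
  have "gauss_moment \<rho> (Suc (Suc t)) = gauss_moment \<rho> (2 * Suc k)" by (simp add: k)
  also have "\<dots> = \<rho>\<^sup>2 * real (Suc t) * gauss_moment \<rho> t"
    unfolding gauss_moment_even[OF assms] k
    by (simp add: power2_eq_square divide_simps add_nonneg_eq_0_iff)
  finally show ?thesis .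
qed (simp add: gauss_moment_odd assms)

text \<open>The expectation of p(w), written through the moments so that everything that follows is
  algebra on coefficients, without integrability conditions.\<close>

definition gauss_expectation :: "real \<Rightarrow> real poly \<Rightarrow> real" where
  "gauss_expectation \<rho> p = (\<Sum>i\<le>degree p. coeff p i * gauss_moment \<rho> i)"

lemma gauss_expectation_upto:
  assumes "degree p \<le> N"
  shows "gauss_expectation \<rho> p = (\<Sum>i\<le>N. coeff p i * gauss_moment \<rho> i)"
  unfolding gauss_expectation_def
  by (rule sum.mono_neutral_left) (use assms in \<open>auto simp: coeff_eq_0\<close>)

lemma gauss_expectation_add: "gauss_expectation \<rho> (p + q) = gauss_expectation \<rho> p + gauss_expectation \<rho> q"
proof -
  let ?N = "max (degree p) (degree q)"
  have "degree (p + q) \<le> ?N" by (rule degree_add_le_max)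
  then show ?thesis
    by (simp add: gauss_expectation_upto[of _ ?N] algebra_simps sum.distrib)
qed

lemma gauss_expectation_smult: "gauss_expectation \<rho> (Polynomial.smult c p) = c * gauss_expectation \<rho> p"
  by (simp add: gauss_expectation_upto[of _ "degree p"] sum_distrib_left mult.assoc)

lemma gauss_expectation_diff: "gauss_expectation \<rho> (p - q) = gauss_expectation \<rho> p - gauss_expectation \<rho> q"
  using gauss_expectation_add[of \<rho> p "- q"] gauss_expectation_smult[of \<rho> "- 1" q] by simp

lemma gauss_expectation_sum: "gauss_expectation \<rho> (\<Sum>i\<in>A. f i) = (\<Sum>i\<in>A. gauss_expectation \<rho> (f i))"
  by (induction A rule: infinite_finite_induct) (auto simp: gauss_expectation_add gauss_expectation_def[of _ 0])

lemma gauss_expectation_monom: "gauss_expectation \<rho> (monom c n) = c * gauss_moment \<rho> n"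
  by (cases "c = 0") (auto simp: gauss_expectation_def degree_monom_eq if_distrib[of "\<lambda>x. x * _"] cong: if_cong)

lemma gauss_expectation_mult:
  assumes "degree p \<le> N" "degree q \<le> N"
  shows "gauss_expectation \<rho> (p * q) = (\<Sum>i\<le>N. \<Sum>j\<le>N. coeff p i * coeff q j * gauss_moment \<rho> (i + j))"
proof -
  have "p * q = (\<Sum>i\<le>N. monom (coeff p i) i) * (\<Sum>j\<le>N. monom (coeff q j) j)"
    using assms by (simp add: poly_as_sum_of_monoms')
  also have "\<dots> = (\<Sum>i\<le>N. \<Sum>j\<le>N. monom (coeff p i * coeff q j) (i + j))"
    by (simp add: sum_product mult_monom)
  finally show ?thesis
    by (simp only: gauss_expectation_sum gauss_expectation_monom)
qed

text \<open>Gaussian integration by parts (Stein's identity), since \<open>pCons 0 p\<close> is X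
  times p. It holds termwise by the moment recursion; the constant term of p only meets the first
  moment, which is 0.\<close>

lemma gauss_expectation_pCons_0:
  assumes "\<rho> > 0"
  shows "gauss_expectation \<rho> (pCons 0 p) = \<rho>\<^sup>2 * gauss_expectation \<rho> (pderiv p)"
proof -
  let ?N = "degree p"
  have d1: "degree (pCons 0 p) \<le> Suc (Suc ?N)" "degree (pderiv p) \<le> ?N"
    by (auto simp: degree_pderiv intro: degree_pCons_le[THEN order_trans])
  have "gauss_expectation \<rho> (pCons 0 p) = (\<Sum>i\<le>Suc ?N. coeff p i * gauss_moment \<rho> (Suc i))"
    unfolding gauss_expectation_upto[OF d1(1)] by (subst sum.atMost_Suc_shift) simp
  also have "\<dots> = (\<Sum>i\<le>?N. coeff p (Suc i) * gauss_moment \<rho> (Suc (Suc i)))"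
    by (subst sum.atMost_Suc_shift) (simp add: gauss_moment_odd assms)
  also have "\<dots> = \<rho>\<^sup>2 * gauss_expectation \<rho> (pderiv p)"
    unfolding gauss_expectation_upto[OF d1(2)]
    by (simp add: gauss_moment_rec[OF assms] sum_distrib_left coeff_pderiv algebra_simps)
  finally show ?thesis .
qed

text \<open>Monic Hermite polynomials for variance \<rho>^2, generated by p -> X p - \<rho>^2 p'. By
  Stein's identity this operator is adjoint to \<rho>^2 times the derivative.\<close>

primrec hermite :: "real \<Rightarrow> nat \<Rightarrow> real poly" where
  "hermite \<rho> 0 = 1"
| "hermite \<rho> (Suc n) = pCons 0 (hermite \<rho> n) - Polynomial.smult (\<rho>\<^sup>2) (pderiv (hermite \<rho> n))"

text \<open>Applying the adjointness n times moves n derivatives onto q.\<close>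

lemma gauss_expectation_hermite_mult:
  assumes "\<rho> > 0"
  shows "gauss_expectation \<rho> (hermite \<rho> n * q) = \<rho> ^ (2 * n) * gauss_expectation \<rho> ((pderiv ^^ n) q)"
proof (induction n arbitrary: q)
  case (Suc n)
  have "hermite \<rho> (Suc n) * q = pCons 0 (hermite \<rho> n * q) - Polynomial.smult (\<rho>\<^sup>2) (pderiv (hermite \<rho> n) * q)"
    by (simp add: algebra_simps)
  then have "gauss_expectation \<rho> (hermite \<rho> (Suc n) * q)
      = \<rho>\<^sup>2 * gauss_expectation \<rho> (pderiv (hermite \<rho> n * q)) - \<rho>\<^sup>2 * gauss_expectation \<rho> (pderiv (hermite \<rho> n) * q)"
    by (simp only: gauss_expectation_diff gauss_expectation_smult gauss_expectation_pCons_0[OF assms])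
  also have "\<dots> = \<rho>\<^sup>2 * gauss_expectation \<rho> (hermite \<rho> n * pderiv q)"
    by (simp add: pderiv_mult gauss_expectation_add algebra_simps)
  also have "\<dots> = \<rho> ^ (2 * Suc n) * gauss_expectation \<rho> ((pderiv ^^ Suc n) q)"
    by (simp add: Suc.IH funpow_swap1 power2_eq_square)
  finally show ?case .
qed simp

lemma coeff_hermite_Suc:
  "coeff (hermite \<rho> (Suc n)) j
    = (case j of 0 \<Rightarrow> 0 | Suc i \<Rightarrow> coeff (hermite \<rho> n) i) - \<rho>\<^sup>2 * (real (Suc j) * coeff (hermite \<rho> n) (Suc j))"
  by (simp add: coeff_pCons coeff_pderiv)

lemma coeff_hermite_eq_0: "j > n \<Longrightarrow> coeff (hermite \<rho> n) j = 0"
  by (induction n arbitrary: j) (auto simp: coeff_hermite_Suc split: nat.splits simp del: hermite.simps(2))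

lemma degree_hermite_le: "degree (hermite \<rho> n) \<le> n"
  by (rule degree_le) (auto simp: coeff_hermite_eq_0)

lemma coeff_hermite_parity: "odd (n + j) \<Longrightarrow> coeff (hermite \<rho> n) j = 0"
proof (induction n arbitrary: j)
  case 0
  then show ?case by (cases j) auto
next
  case (Suc n)
  then show ?case by (auto simp: coeff_hermite_Suc split: nat.splits simp del: hermite.simps(2))
qed

lemma coeff_hermite:
  "coeff (hermite \<rho> (j + 2 * m)) j
    = (- \<rho>\<^sup>2) ^ m * fact (j + 2 * m) / (fact m * fact j * 2 ^ m)"
proof (induction "j + 2 * m" arbitrary: j m)
  case 0
  then show ?case by simp
next
  case (Suc n)
  show ?case
  proof (cases m)
    case 0
    with Suc(2) have j: "j = Suc n" by simp
    have "coeff (hermite \<rho> n) n = 1" using Suc(1)[of n 0] by simp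
    then show ?thesis
      by (simp add: 0 j coeff_hermite_Suc coeff_hermite_eq_0 del: hermite.simps(2))
  next
    case (Suc m')
    have n: "n = Suc j + 2 * m'" using Suc(1) \<open>Suc n = j + 2 * m\<close> by simp
    have 1: "coeff (hermite \<rho> n) (Suc j) = (- \<rho>\<^sup>2) ^ m' * fact n / (fact m' * fact (Suc j) * 2 ^ m')"
      using \<open>\<And>j m. n = j + 2 * m \<Longrightarrow> _\<close>[OF n] n by simp
    have 2: "(case j of 0 \<Rightarrow> 0 | Suc i \<Rightarrow> coeff (hermite \<rho> n) i)
        = real j * (- \<rho>\<^sup>2) ^ m * fact n / (fact m * fact j * 2 ^ m)"
    proof (cases j)
      case (Suc i)
      have n': "n = i + 2 * m" using Suc \<open>Suc n = j + 2 * m\<close> by simp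
      show ?thesis
        using \<open>\<And>j m. n = j + 2 * m \<Longrightarrow> _\<close>[OF n'] n' Suc by (simp add: divide_simps)
    qed simp
    \<comment> \<open>Relative to the common factor, the shifted term has weight j (hence 0 when j =
      0) and the derivative term has weight 2m; they add up to the new degree.\<close>
    have "coeff (hermite \<rho> (Suc n)) j = (- \<rho>\<^sup>2) ^ m * fact n / (fact m * fact j * 2 ^ m) * (real j + 2 * real m)"
      unfolding coeff_hermite_Suc 1 2 Suc by (simp add: divide_simps) (simp add: algebra_simps)
    also have "real j + 2 * real m = real (Suc n)" using \<open>Suc n = j + 2 * m\<close> by simp
    finally show ?thesis unfolding \<open>Suc n = j + 2 * m\<close>[symmetric] by (simp add: field_simps)
  qed
qed

text \<open>For m \<le> n the n-th derivative of the m-th polynomial is 0, or the constant n! when m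
  = n because the polynomial is monic. The other case follows by commuting the factors.\<close>

lemma hermite_orthogonal:
  assumes "\<rho> > 0"
  shows "gauss_expectation \<rho> (hermite \<rho> n * hermite \<rho> m) = (if n = m then \<rho> ^ (2 * n) * fact n else 0)"
proof -
  have main: "gauss_expectation \<rho> (hermite \<rho> n * hermite \<rho> m) = (if n = m then \<rho> ^ (2 * n) * fact n else 0)"
    if "m \<le> n" for n m
  proof -
    have "(pderiv ^^ n) (hermite \<rho> m) = (if n = m then [:fact n:] else 0)"
    proof (rule poly_eqI)
      fix i
      show "coeff ((pderiv ^^ n) (hermite \<rho> m)) i = coeff (if n = m then [:fact n:] else 0) i"
        using that coeff_hermite[of \<rho> n 0]
        by (cases i) (auto simp: coeff_higher_pderiv coeff_hermite_eq_0 pochhammer_fact[symmetric])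
    qed
    moreover have "gauss_moment \<rho> 0 = 1" using gauss_moment_even[OF assms, of 0] by simp
    ultimately show ?thesis
      by (simp add: gauss_expectation_hermite_mult[OF assms] gauss_expectation_def[of \<rho> "[:_:]"]
          gauss_expectation_def[of \<rho> 0])
  qed
  show ?thesis
  proof (cases "m \<le> n")
    case False
    then show ?thesis using main[of n m] by (subst mult.commute) auto
  qed (rule main)
qed

section \<open>Orthonormal coefficients and the inverse of the Hankel matrix\<close>

definition orthonormal_coeff :: "real \<Rightarrow> nat \<Rightarrow> nat \<Rightarrow> real" where
  "orthonormal_coeff \<rho> n j = coeff (hermite \<rho> n) j / (\<rho> ^ n * sqrt (fact n))"

text \<open>The coefficient of X^j Y^k in the Christoffel-Darboux kernel of degree T.\<close>

definition inv_hankel :: "real \<Rightarrow> nat \<Rightarrow> nat \<Rightarrow> nat \<Rightarrow> real" where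
  "inv_hankel \<rho> T j k = (\<Sum>n\<le>T. orthonormal_coeff \<rho> n j * orthonormal_coeff \<rho> n k)"

lemma orthonormal_coeff_relation:
  assumes "\<rho> > 0" "n \<le> T" "m \<le> T"
  shows "(\<Sum>i\<le>T. \<Sum>j\<le>T. orthonormal_coeff \<rho> n i * gauss_moment \<rho> (i + j) * orthonormal_coeff \<rho> m j)
    = (if n = m then 1 else 0)"
proof -
  have "(\<Sum>i\<le>T. \<Sum>j\<le>T. orthonormal_coeff \<rho> n i * gauss_moment \<rho> (i + j) * orthonormal_coeff \<rho> m j)
    = gauss_expectation \<rho> (hermite \<rho> n * hermite \<rho> m) / (\<rho> ^ n * sqrt (fact n) * (\<rho> ^ m * sqrt (fact m)))"
    using assms degree_hermite_le[THEN order_trans]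
    by (subst gauss_expectation_mult[of _ T])
       (auto simp: orthonormal_coeff_def sum_divide_distrib intro!: sum.cong)
  also have "\<rho> ^ n * sqrt (fact n) * (\<rho> ^ n * sqrt (fact n)) = (\<rho> ^ n)\<^sup>2 * (sqrt (fact n))\<^sup>2" for n
    by (simp only: power2_eq_square mult_ac)
  then have "gauss_expectation \<rho> (hermite \<rho> n * hermite \<rho> m) / (\<rho> ^ n * sqrt (fact n) * (\<rho> ^ m * sqrt (fact m)))
      = (if n = m then 1 else 0)"
    using assms by (simp add: hermite_orthogonal mult.commute[of 2] flip: power_mult)
  finally show ?thesis .
qed

lemma hankel_mult_inv_hankel:
  fixes \<rho> :: real and T :: nat
  assumes "\<rho> > 0"
  defines "C \<equiv> mat (T + 1) (T + 1) (\<lambda>(j, k). inv_hankel \<rho> T j k)"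
  shows "hankel_B \<rho> T * C = 1\<^sub>m (T + 1)" "C * hankel_B \<rho> T = 1\<^sub>m (T + 1)"
proof -
  define L where "L = mat (T + 1) (T + 1) (\<lambda>(n, j). orthonormal_coeff \<rho> n j)"
  define B where "B = hankel_B \<rho> T"
  have c: "L \<in> carrier_mat (T+1) (T+1)" "B \<in> carrier_mat (T+1) (T+1)" "transpose_mat L \<in> carrier_mat (T+1) (T+1)"
    "C \<in> carrier_mat (T+1) (T+1)"
    by (auto simp: L_def B_def hankel_B_def C_def)
  have seteq: "{0..<Suc T} = {..T}" by auto
  have "L * (B * transpose_mat L) = 1\<^sub>m (T + 1)"
  proof (rule eq_matI)
    fix n m assume "n < dim_row (1\<^sub>m (T + 1) :: real mat)" "m < dim_col (1\<^sub>m (T + 1) :: real mat)"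
    then have nm: "n \<le> T" "m \<le> T" by auto
    then have "(L * (B * transpose_mat L)) $$ (n, m)
       = (\<Sum>i\<le>T. \<Sum>j\<le>T. orthonormal_coeff \<rho> n i * gauss_moment \<rho> (i + j) * orthonormal_coeff \<rho> m j)"
      by (auto simp: L_def B_def hankel_B_def scalar_prod_def seteq sum_distrib_left mult.assoc intro!: sum.cong)
    then show "(L * (B * transpose_mat L)) $$ (n, m) = 1\<^sub>m (T + 1) $$ (n, m)"
      using nm by (simp add: orthonormal_coeff_relation[OF assms(1) nm])
  qed (use c in auto)
  \<comment> \<open>Orthonormality says that \<open>L\<close> is a left inverse of
    \<open>B * transpose_mat L\<close>; for square matrices it is then also a right inverse, which
    brings the two factors of \<open>C\<close> together.\<close>
  then have "(B * transpose_mat L) * L = 1\<^sub>m (T + 1)"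
    by (rule mat_mult_left_right_inverse[rotated 2]) (use c in auto)
  moreover have "C = transpose_mat L * L"
    by (rule eq_matI) (auto simp: C_def L_def inv_hankel_def scalar_prod_def seteq intro!: sum.cong)
  ultimately show *: "hankel_B \<rho> T * C = 1\<^sub>m (T + 1)"
    using c by (simp add: assoc_mult_mat[of _ "T+1" "T+1" _ "T+1" _ "T+1"] flip: B_def)
  show "C * hankel_B \<rho> T = 1\<^sub>m (T + 1)"
    by (rule mat_mult_left_right_inverse[OF _ _ *]) (use c B_def in auto)
qed

section \<open>Spectral bounds\<close>

text \<open>The values p = 0 and p = 1 select the even and the odd block; the encoding by
  \<open>even (j + p)\<close> lets one argument serve both.\<close>

definition parity_trace :: "real \<Rightarrow> nat \<Rightarrow> nat \<Rightarrow> real" where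
  "parity_trace \<rho> T p = (\<Sum>j | j \<le> T \<and> even (j + p). inv_hankel \<rho> T j j)"

lemma inv_hankel_diag_nonneg: "inv_hankel \<rho> T j j \<ge> 0"
  by (auto simp: inv_hankel_def intro!: sum_nonneg)

lemma sum_parity_split:
  fixes f :: "nat \<Rightarrow> 'a::comm_monoid_add"
  shows "(\<Sum>j\<le>T. f j) = (\<Sum>j | j \<le> T \<and> even (j + 0). f j) + (\<Sum>j | j \<le> T \<and> even (j + 1). f j)"
proof -
  have "{..T} = {j. j \<le> T \<and> even (j + 0)} \<union> {j. j \<le> T \<and> even (j + 1)}" by auto
  then show ?thesis by (simp only:) (rule sum.union_disjoint; force)
qed

lemma inv_hankel_quadratic_form:
  "(\<Sum>j\<le>T. \<Sum>k\<le>T. v j * inv_hankel \<rho> T j k * v k) = (\<Sum>n\<le>T. (\<Sum>j\<le>T. orthonormal_coeff \<rho> n j * v j)\<^sup>2)"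
  (is "?lhs = _")
proof -
  let ?L = "orthonormal_coeff \<rho>"
  have "?lhs = (\<Sum>j\<le>T. \<Sum>k\<le>T. \<Sum>n\<le>T. (?L n j * v j) * (?L n k * v k))"
    by (simp add: inv_hankel_def sum_distrib_left sum_distrib_right mult_ac)
  also have "\<dots> = (\<Sum>j\<le>T. \<Sum>n\<le>T. \<Sum>k\<le>T. (?L n j * v j) * (?L n k * v k))"
    by (intro sum.cong refl sum.swap)
  also have "\<dots> = (\<Sum>n\<le>T. \<Sum>j\<le>T. \<Sum>k\<le>T. (?L n j * v j) * (?L n k * v k))"
    by (rule sum.swap)
  also have "\<dots> = (\<Sum>n\<le>T. (\<Sum>j\<le>T. ?L n j * v j)\<^sup>2)"
    by (simp add: sum_product power2_eq_square)
  finally show ?thesis .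
qed

text \<open>Row n of L is supported on indices of the parity of n, so the form splits into two.
  Cauchy-Schwarz in each row leaves the squared entries of L within a block, whose sum is bounded by
  the trace of that block.\<close>

lemma inv_hankel_quadratic_form_le:
  "(\<Sum>j\<le>T. \<Sum>k\<le>T. v j * inv_hankel \<rho> T j k * v k)
    \<le> max (parity_trace \<rho> T 0) (parity_trace \<rho> T 1) * (\<Sum>j\<le>T. (v j)\<^sup>2)"
proof -
  let ?E = "\<lambda>p. {j. j \<le> T \<and> even (j + p)}"
  let ?L = "orthonormal_coeff \<rho>"
  have L0: "odd (n + j) \<Longrightarrow> ?L n j = 0" for n j
    by (simp add: orthonormal_coeff_def coeff_hermite_parity)
  have "(\<Sum>j\<le>T. \<Sum>k\<le>T. v j * inv_hankel \<rho> T j k * v k) = (\<Sum>n\<le>T. (\<Sum>j\<le>T. ?L n j * v j)\<^sup>2)"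
    by (rule inv_hankel_quadratic_form)
  also have "\<dots> = (\<Sum>p<2. \<Sum>n\<in>?E p. (\<Sum>j\<le>T. ?L n j * v j)\<^sup>2)"
    by (subst sum_parity_split) (simp add: numeral_2_eq_2)
  also have "\<dots> \<le> (\<Sum>p<2. parity_trace \<rho> T p * (\<Sum>j\<in>?E p. (v j)\<^sup>2))"
  proof (rule sum_mono)
    fix p :: nat
    have "(\<Sum>n\<in>?E p. (\<Sum>j\<le>T. ?L n j * v j)\<^sup>2) \<le> (\<Sum>n\<in>?E p. (\<Sum>j\<in>?E p. (?L n j)\<^sup>2) * (\<Sum>j\<in>?E p. (v j)\<^sup>2))"
    proof (rule sum_mono)
      fix n assume "n \<in> ?E p"
      then have "(\<Sum>j\<le>T. ?L n j * v j) = (\<Sum>j\<in>?E p. ?L n j * v j)"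
        by (intro sum.mono_neutral_right) (auto intro!: L0)
      then show "(\<Sum>j\<le>T. ?L n j * v j)\<^sup>2 \<le> (\<Sum>j\<in>?E p. (?L n j)\<^sup>2) * (\<Sum>j\<in>?E p. (v j)\<^sup>2)"
        using Cauchy_Schwarz_ineq_sum by metis
    qed
    also have "\<dots> = (\<Sum>j\<in>?E p. \<Sum>n\<in>?E p. (?L n j)\<^sup>2) * (\<Sum>j\<in>?E p. (v j)\<^sup>2)"
      by (subst sum.swap) (simp add: sum_distrib_right)
    also have "\<dots> \<le> parity_trace \<rho> T p * (\<Sum>j\<in>?E p. (v j)\<^sup>2)"
      unfolding parity_trace_def inv_hankel_def
      by (intro mult_right_mono sum_mono) (auto simp: power2_eq_square intro!: sum_nonneg sum_mono2)
    finally show "(\<Sum>n\<in>?E p. (\<Sum>j\<le>T. ?L n j * v j)\<^sup>2) \<le> parity_trace \<rho> T p * (\<Sum>j\<in>?E p. (v j)\<^sup>2)" .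
  qed
  also have "\<dots> \<le> (\<Sum>p<2. max (parity_trace \<rho> T 0) (parity_trace \<rho> T 1) * (\<Sum>j\<in>?E p. (v j)\<^sup>2))"
    by (auto simp: numeral_2_eq_2 intro!: add_mono mult_right_mono sum_nonneg)
  also have "\<dots> = max (parity_trace \<rho> T 0) (parity_trace \<rho> T 1) * (\<Sum>j\<le>T. (v j)\<^sup>2)"
    unfolding sum_parity_split[of "\<lambda>j. (v j)\<^sup>2"] by (simp add: numeral_2_eq_2 algebra_simps)
  finally show ?thesis .
qed

section \<open>Eigenvalues of the Hankel matrix and of its inverse\<close>

lemma eigenvalue_inverse_mat:
  fixes A :: "'a::field mat"
  assumes A: "A \<in> carrier_mat n n" and C: "C \<in> carrier_mat n n" and inv: "C * A = 1\<^sub>m n"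
    and ev: "eigenvalue A e"
  shows "e \<noteq> 0" "eigenvalue C (1 / e)"
proof -
  from ev obtain v where v: "v \<in> carrier_vec n" "v \<noteq> 0\<^sub>v n" "A *\<^sub>v v = e \<cdot>\<^sub>v v"
    using A by (auto simp: eigenvalue_def eigenvector_def)
  have "v = C * A *\<^sub>v v" using v inv by simp
  also have "\<dots> = C *\<^sub>v (e \<cdot>\<^sub>v v)" using A C v by (simp add: assoc_mult_mat_vec)
  also have "\<dots> = e \<cdot>\<^sub>v (C *\<^sub>v v)" using C v by (simp add: mult_mat_vec)
  finally have eq: "v = e \<cdot>\<^sub>v (C *\<^sub>v v)" .
  show e: "e \<noteq> 0"
  proof
    assume "e = 0"
    then have "v = 0 \<cdot>\<^sub>v (C *\<^sub>v v)" using eq by simp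
    also have "\<dots> = 0\<^sub>v n" using C by auto
    finally have "v = 0\<^sub>v n" .
    then show False using v by simp
  qed
  have "(1 / e) \<cdot>\<^sub>v v = (1 / e) \<cdot>\<^sub>v (e \<cdot>\<^sub>v (C *\<^sub>v v))" using eq by simp
  also have "\<dots> = C *\<^sub>v v" using e by (simp add: smult_smult_assoc)
  finally show "eigenvalue C (1 / e)"
    using v C by (auto simp: eigenvalue_def eigenvector_def)
qed

locale gauss_hankel =
  fixes \<rho> :: real and T :: nat
  assumes rho_pos: "\<rho> > 0"
begin

definition inv_hankel_mat :: "real mat" where
  "inv_hankel_mat = mat (T + 1) (T + 1) (\<lambda>(j, k). inv_hankel \<rho> T j k)"

lemma carriers: "hankel_B \<rho> T \<in> carrier_mat (T + 1) (T + 1)" "inv_hankel_mat \<in> carrier_mat (T + 1) (T + 1)"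
  by (auto simp: hankel_B_def inv_hankel_mat_def)

lemma inverses: "hankel_B \<rho> T * inv_hankel_mat = 1\<^sub>m (T + 1)" "inv_hankel_mat * hankel_B \<rho> T = 1\<^sub>m (T + 1)"
  using hankel_mult_inv_hankel[OF rho_pos, of T] by (auto simp: inv_hankel_mat_def)

lemma inv_hankel_mat_sym: "j < T + 1 \<Longrightarrow> k < T + 1 \<Longrightarrow> inv_hankel_mat $$ (j, k) = inv_hankel_mat $$ (k, j)"
  by (auto simp: inv_hankel_mat_def inv_hankel_def mult.commute)

lemma hankel_sym: "j < T + 1 \<Longrightarrow> k < T + 1 \<Longrightarrow> hankel_B \<rho> T $$ (j, k) = hankel_B \<rho> T $$ (k, j)"
  by (auto simp: hankel_B_def add.commute)

text \<open>Pairing the eigenvector equation with v gives \<mu> |v|^2 as the quadratic form. That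
  form is a sum of squares, and invertibility excludes \<mu> = 0.\<close>

lemma eigenvalue_inv_hankel_mat:
  assumes "eigenvalue inv_hankel_mat \<mu>"
  shows "0 < \<mu>" "\<mu> \<le> max (parity_trace \<rho> T 0) (parity_trace \<rho> T 1)"
proof -
  from assms obtain v where v: "v \<in> carrier_vec (T + 1)" "v \<noteq> 0\<^sub>v (T + 1)" "inv_hankel_mat *\<^sub>v v = \<mu> \<cdot>\<^sub>v v"
    using carriers by (auto simp: eigenvalue_def eigenvector_def)
  have seteq: "{0..<Suc T} = {..T}" by auto
  have "(\<Sum>k\<le>T. inv_hankel \<rho> T j k * v $ k) = \<mu> * v $ j" if "j \<le> T" for j
  proof -
    have "(inv_hankel_mat *\<^sub>v v) $ j = (\<Sum>k\<le>T. inv_hankel \<rho> T j k * v $ k)"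
      using that v(1) by (auto simp: inv_hankel_mat_def scalar_prod_def seteq)
    then show ?thesis using v that by simp
  qed
  then have "(\<Sum>j\<le>T. v $ j * (\<Sum>k\<le>T. inv_hankel \<rho> T j k * v $ k)) = (\<Sum>j\<le>T. v $ j * (\<mu> * v $ j))"
    by (intro sum.cong) auto
  then have q: "(\<Sum>j\<le>T. \<Sum>k\<le>T. v $ j * inv_hankel \<rho> T j k * v $ k) = \<mu> * (\<Sum>j\<le>T. (v $ j)\<^sup>2)"
    by (simp add: sum_distrib_left power2_eq_square mult_ac)
  obtain j where j: "j \<le> T" "v $ j \<noteq> 0"
    using v(1,2) by (metis Suc_eq_plus1 carrier_vecD eq_vecI index_zero_vec(1) index_zero_vec(2) less_Suc_eq_le)
  have "0 < (v $ j)\<^sup>2" using j by simp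
  also have "\<dots> \<le> (\<Sum>j\<le>T. (v $ j)\<^sup>2)"
    by (rule member_le_sum[where f = "\<lambda>j. (v $ j)\<^sup>2"]) (use j in auto)
  finally have pos: "(\<Sum>j\<le>T. (v $ j)\<^sup>2) > 0" .
  show "\<mu> \<le> max (parity_trace \<rho> T 0) (parity_trace \<rho> T 1)"
    using inv_hankel_quadratic_form_le[of "\<lambda>j. v $ j" \<rho> T] pos unfolding q by simp
  have "(\<Sum>j\<le>T. \<Sum>k\<le>T. v $ j * inv_hankel \<rho> T j k * v $ k) \<ge> 0"
    unfolding inv_hankel_quadratic_form[of "\<lambda>j. v $ j"] by (intro sum_nonneg) auto
  then have "\<mu> \<ge> 0" using pos unfolding q by (simp add: zero_le_mult_iff)
  then show "\<mu> > 0"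
    using eigenvalue_inverse_mat(1)[OF carriers(2,1) inverses(1) assms] by simp
qed

lemma eigenvalue_hankel_iff: "eigenvalue (hankel_B \<rho> T) e \<longleftrightarrow> e \<noteq> 0 \<and> eigenvalue inv_hankel_mat (1 / e)"
  using eigenvalue_inverse_mat[OF carriers(1,2) inverses(2), of e]
    eigenvalue_inverse_mat[OF carriers(2,1) inverses(1), of "1 / e"] by auto

lemma eigenvalue_hankel_pos: "eigenvalue (hankel_B \<rho> T) e \<Longrightarrow> e > 0"
  using eigenvalue_hankel_iff eigenvalue_inv_hankel_mat(1)[of "1 / e"] by auto

lemma hankel_roots:
  obtains es where "char_poly (hankel_B \<rho> T) = (\<Prod>e\<leftarrow>es. [:- e, 1:])" "length es = T + 1"
    "eigs_B \<rho> T = mset es" "set es = {e. eigenvalue (hankel_B \<rho> T) e}"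
proof -
  obtain es where es: "char_poly (hankel_B \<rho> T) = (\<Prod>e\<leftarrow>es. [:- e, 1:])" "length es = T + 1"
    by (rule real_symmetric_char_poly_splits[OF carriers(1) hankel_sym]) auto
  have "set es = {e. eigenvalue (hankel_B \<rho> T) e}"
    by (auto simp: eigenvalue_root_char_poly[OF carriers(1)] es poly_prod_list prod_list_zero_iff o_def image_iff)
  then show ?thesis
    using that[OF es] by (simp add: eigs_B_def es(1) proots_prod_list_linear)
qed

lemma inv_hankel_mat_roots:
  obtains ms where "char_poly inv_hankel_mat = (\<Prod>e\<leftarrow>ms. [:- e, 1:])" "length ms = T + 1"
    "set ms = {e. eigenvalue inv_hankel_mat e}"
proof -
  obtain es where es: "char_poly inv_hankel_mat = (\<Prod>e\<leftarrow>es. [:- e, 1:])" "length es = T + 1"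
    by (rule real_symmetric_char_poly_splits[OF carriers(2) inv_hankel_mat_sym]) auto
  have "set es = {e. eigenvalue inv_hankel_mat e}"
    by (auto simp: eigenvalue_root_char_poly[OF carriers(2)] es poly_prod_list prod_list_zero_iff o_def image_iff)
  then show ?thesis using that[OF es] by simp
qed

lemma lambda_sum_eq: "lambda_sum \<rho> T = (\<Sum>i\<le>T. gauss_moment \<rho> (2 * i))"
proof -
  obtain es where es: "char_poly (hankel_B \<rho> T) = (\<Prod>e\<leftarrow>es. [:- e, 1:])" "eigs_B \<rho> T = mset es"
    by (rule hankel_roots)
  have "lambda_sum \<rho> T = trace_mat (hankel_B \<rho> T)"
    using sum_list_char_poly_roots(1)[OF carriers(1) es(1)] es(2) by (simp add: lambda_sum_def sum_mset_sum_list)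
  also have "\<dots> = (\<Sum>i\<le>T. gauss_moment \<rho> (2 * i))"
    by (auto simp: trace_mat_def hankel_B_def lessThan_Suc_atMost mult_2 intro!: sum.cong)
  finally show ?thesis .
qed

text \<open>The second bound keeps only the corner entry of the sum of squares that represents tr
  B^2.\<close>

lemma lambda_max_bounds:
  "lambda_max \<rho> T \<le> lambda_sum \<rho> T"
  "(gauss_moment \<rho> (2 * T))\<^sup>2 \<le> lambda_max \<rho> T * lambda_sum \<rho> T"
proof -
  obtain es where es: "char_poly (hankel_B \<rho> T) = (\<Prod>e\<leftarrow>es. [:- e, 1:])" "length es = T + 1"
    "eigs_B \<rho> T = mset es" "set es = {e. eigenvalue (hankel_B \<rho> T) e}"
    by (rule hankel_roots)
  have ne: "es \<noteq> []" using es(2) by auto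
  have pos: "e > 0" if "e \<in> set es" for e using that es(4) eigenvalue_hankel_pos by auto
  have max: "lambda_max \<rho> T = Max (set es)" by (simp add: lambda_max_def es(3))
  have sum: "lambda_sum \<rho> T = sum_list es" by (simp add: lambda_sum_def es(3) sum_mset_sum_list)
  have "Max (set es) \<in> set es" using ne by simp
  then show "lambda_max \<rho> T \<le> lambda_sum \<rho> T"
    unfolding max sum using pos by (intro member_le_sum_list) (auto intro: less_imp_le)
  have tr: "trace_mat (hankel_B \<rho> T) = lambda_sum \<rho> T"
    unfolding sum by (rule sum_list_char_poly_roots(1)[OF carriers(1) es(1)])
  have "(gauss_moment \<rho> (2 * T))\<^sup>2 = (hankel_B \<rho> T $$ (T, T))\<^sup>2"
    by (simp add: hankel_B_def mult_2)
  also have "\<dots> \<le> (\<Sum>j<T+1. (hankel_B \<rho> T $$ (T, j))\<^sup>2)"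
    by (rule member_le_sum[where f = "\<lambda>j. (hankel_B \<rho> T $$ (T, j))\<^sup>2"]) auto
  also have "\<dots> \<le> (\<Sum>i<T+1. \<Sum>j<T+1. (hankel_B \<rho> T $$ (i, j))\<^sup>2)"
    by (rule member_le_sum[where f = "\<lambda>i. \<Sum>j<T+1. (hankel_B \<rho> T $$ (i, j))\<^sup>2"]) (auto intro!: sum_nonneg add_nonneg_nonneg)
  also have "\<dots> = trace_mat (hankel_B \<rho> T * hankel_B \<rho> T)"
    by (rule trace_mat_square_symmetric[OF carriers(1) hankel_sym, symmetric])
  also have "\<dots> \<le> Max (set es) * trace_mat (hankel_B \<rho> T)"
    by (rule max_root_ge_trace_quotient[OF carriers(1) es(1) _ ne]) (use pos in \<open>auto intro: less_imp_le\<close>)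
  finally show "(gauss_moment \<rho> (2 * T))\<^sup>2 \<le> lambda_max \<rho> T * lambda_sum \<rho> T"
    unfolding max tr .
qed

text \<open>Eigenvalues of B and C are reciprocal to each other, so the largest root of C is at most
  \<open>1 / lambda_min \<rho> T\<close>; the third bound is then tr C^2 \<le> Max tr C.\<close>

lemma lambda_min_bounds:
  "lambda_min \<rho> T > 0"
  "1 / lambda_min \<rho> T \<le> max (parity_trace \<rho> T 0) (parity_trace \<rho> T 1)"
  "(\<Sum>j\<le>T. \<Sum>k\<le>T. (inv_hankel \<rho> T j k)\<^sup>2)
     \<le> 1 / lambda_min \<rho> T * (parity_trace \<rho> T 0 + parity_trace \<rho> T 1)"
proof -
  obtain es where es: "char_poly (hankel_B \<rho> T) = (\<Prod>e\<leftarrow>es. [:- e, 1:])" "length es = T + 1"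
    "eigs_B \<rho> T = mset es" "set es = {e. eigenvalue (hankel_B \<rho> T) e}"
    by (rule hankel_roots)
  obtain ms where ms: "char_poly inv_hankel_mat = (\<Prod>e\<leftarrow>ms. [:- e, 1:])" "length ms = T + 1"
    "set ms = {e. eigenvalue inv_hankel_mat e}"
    by (rule inv_hankel_mat_roots)
  have ne: "es \<noteq> []" "ms \<noteq> []" using es(2) ms(2) by auto
  have min: "lambda_min \<rho> T = Min (set es)" by (simp add: lambda_min_def es(3))
  have mem: "Min (set es) \<in> set es" using ne by simp
  then have evB: "eigenvalue (hankel_B \<rho> T) (lambda_min \<rho> T)" using es(4) min by simp
  then show pos: "lambda_min \<rho> T > 0" by (rule eigenvalue_hankel_pos)
  have ev: "eigenvalue inv_hankel_mat (1 / lambda_min \<rho> T)" using evB eigenvalue_hankel_iff by blast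
  then show "1 / lambda_min \<rho> T \<le> max (parity_trace \<rho> T 0) (parity_trace \<rho> T 1)"
    by (rule eigenvalue_inv_hankel_mat)
  have "Max (set ms) \<in> set ms" using ne by simp
  then have evm: "eigenvalue inv_hankel_mat (Max (set ms))" using ms(3) by simp
  then have mpos: "Max (set ms) > 0" by (rule eigenvalue_inv_hankel_mat)
  have "eigenvalue (hankel_B \<rho> T) (1 / Max (set ms))"
    using evm mpos by (simp add: eigenvalue_hankel_iff)
  then have "lambda_min \<rho> T \<le> 1 / Max (set ms)"
    unfolding min by (intro Min_le) (simp_all only: es(4)[symmetric] finite_set mem_Collect_eq, simp_all add: es(4))
  then have le: "Max (set ms) \<le> 1 / lambda_min \<rho> T" using pos mpos by (simp add: field_simps)
  have tr: "trace_mat inv_hankel_mat = parity_trace \<rho> T 0 + parity_trace \<rho> T 1"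
    unfolding parity_trace_def sum_parity_split[symmetric]
    by (auto simp: trace_mat_def inv_hankel_mat_def lessThan_Suc_atMost intro!: sum.cong)
  have "(\<Sum>j\<le>T. \<Sum>k\<le>T. (inv_hankel \<rho> T j k)\<^sup>2) = (\<Sum>j<T+1. \<Sum>k<T+1. (inv_hankel_mat $$ (j, k))\<^sup>2)"
    by (auto simp: inv_hankel_mat_def lessThan_Suc_atMost intro!: sum.cong)
  also have "\<dots> = trace_mat (inv_hankel_mat * inv_hankel_mat)"
    by (rule trace_mat_square_symmetric[OF carriers(2) inv_hankel_mat_sym, symmetric])
  also have "\<dots> \<le> Max (set ms) * trace_mat inv_hankel_mat"
    by (rule max_root_ge_trace_quotient[OF carriers(2) ms(1) _ ne(2)])
       (use ms(3) eigenvalue_inv_hankel_mat(1) in \<open>auto intro: less_imp_le\<close>)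
  also have "\<dots> \<le> 1 / lambda_min \<rho> T * trace_mat inv_hankel_mat"
    using le unfolding tr parity_trace_def
    by (intro mult_right_mono add_nonneg_nonneg sum_nonneg inv_hankel_diag_nonneg)
  finally show "(\<Sum>j\<le>T. \<Sum>k\<le>T. (inv_hankel \<rho> T j k)\<^sup>2)
     \<le> 1 / lambda_min \<rho> T * (parity_trace \<rho> T 0 + parity_trace \<rho> T 1)"
    unfolding tr .
qed

end

section \<open>Entries of the inverse Hankel matrix\<close>

text \<open>This is binom(2m, m) / 4^m. It enters twice: in the squares of the Hermite coefficients,
  with m = (n - j) / 2, and in the comparison of (x^j / j!)^2 with a term of cosh 2x, with m =
  j.\<close>

definition central_ratio :: "nat \<Rightarrow> real" where
  "central_ratio m = fact (2 * m) / (4 ^ m * (fact m)\<^sup>2)"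

lemma central_ratio_pos: "central_ratio m > 0"
  by (simp add: central_ratio_def)

lemma central_ratio_Suc: "central_ratio (Suc m) = central_ratio m * ((2 * real m + 1) / (2 * real m + 2))"
  by (simp add: central_ratio_def power2_eq_square divide_simps add_nonneg_eq_0_iff) (simp add: algebra_simps)

lemma central_ratio_le_1: "central_ratio m \<le> 1"
proof (induction m)
  case (Suc m)
  have "central_ratio m * ((2 * real m + 1) / (2 * real m + 2)) \<le> 1 * 1"
    using Suc by (intro mult_mono) (auto simp: less_imp_le[OF central_ratio_pos])
  then show ?case by (simp add: central_ratio_Suc)
qed (simp add: central_ratio_def)

text \<open>Partial products in the form of the fact \<open>wallis\<close>, with limit pi /
  2.\<close>

definition wallis_prod :: "nat \<Rightarrow> real" where
  "wallis_prod n = (\<Prod>k=1..n. (4 * real k ^ 2) / (4 * real k ^ 2 - 1))"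

lemma wallis_prod_Suc:
  "wallis_prod (Suc n) = wallis_prod n * ((2 * real n + 2)\<^sup>2 / ((2 * real n + 1) * (2 * real n + 3)))"
proof -
  have "4 * (real (Suc n))\<^sup>2 - 1 = (2 * real n + 1) * (2 * real n + 3)"
    "4 * (real (Suc n))\<^sup>2 = (2 * real n + 2)\<^sup>2"
    by (simp_all add: power2_eq_square algebra_simps)
  then show ?thesis by (simp add: wallis_prod_def del: of_nat_Suc)
qed

lemma wallis_prod_pos: "wallis_prod n > 0"
  by (induction n) (simp add: wallis_prod_def, simp add: wallis_prod_Suc zero_less_mult_iff add_nonneg_pos)

text \<open>The growth factors cancel exactly from n to n + 1. Monotonicity of Wallis-type sequences
  thereby gives bounds on \<open>central_ratio\<close> for every index, not only in the
  limit.\<close>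

lemma central_ratio_wallis: "(central_ratio n)\<^sup>2 * (2 * real n + 1) * wallis_prod n = 1"
proof (induction n)
  case (Suc n)
  have "2 * real n + 1 \<noteq> 0" "2 * real n + 2 \<noteq> 0" "2 * real n + 3 \<noteq> 0" by linarith+
  then have *: "((2 * real n + 1) / (2 * real n + 2))\<^sup>2 * (2 * real n + 3)
      * ((2 * real n + 2)\<^sup>2 / ((2 * real n + 1) * (2 * real n + 3))) = 2 * real n + 1"
    by (simp add: power_divide power2_eq_square)
  have "(central_ratio (Suc n))\<^sup>2 * (2 * real (Suc n) + 1) * wallis_prod (Suc n)
     = (central_ratio n)\<^sup>2 * (((2 * real n + 1) / (2 * real n + 2))\<^sup>2 * (2 * real n + 3)
        * ((2 * real n + 2)\<^sup>2 / ((2 * real n + 1) * (2 * real n + 3)))) * wallis_prod n"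
    unfolding central_ratio_Suc wallis_prod_Suc power_mult_distrib by (simp add: add.commute)
  then show ?case using Suc unfolding * by simp
qed (simp add: central_ratio_def wallis_prod_def)

text \<open>The Wallis products increase, so each is at most the limit pi / 2.\<close>

lemma central_ratio_lower: "central_ratio m \<ge> 1 / sqrt (pi * (real m + 1 / 2))"
proof -
  have inc: "incseq wallis_prod"
  proof (rule incseq_SucI)
    fix n
    have "(2 * real n + 2)\<^sup>2 \<ge> (2 * real n + 1) * (2 * real n + 3)"
      by (simp add: power2_eq_square algebra_simps)
    moreover have "(2 * real n + 1) * (2 * real n + 3) > 0" by (simp add: add_nonneg_pos)
    ultimately have "(2 * real n + 2)\<^sup>2 / ((2 * real n + 1) * (2 * real n + 3)) \<ge> 1"
      by (simp only: le_divide_eq_1_pos)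
    from mult_left_mono[OF this less_imp_le[OF wallis_prod_pos[of n]]]
    show "wallis_prod n \<le> wallis_prod (Suc n)" by (simp add: wallis_prod_Suc)
  qed
  have P: "wallis_prod m \<le> pi / 2"
    by (rule incseq_le[OF inc wallis[folded wallis_prod_def]])
  have "1 \<le> (central_ratio m)\<^sup>2 * (2 * real m + 1) * (pi / 2)"
    using mult_left_mono[OF P, of "(central_ratio m)\<^sup>2 * (2 * real m + 1)"]
    unfolding central_ratio_wallis by simp
  then have "1 / (pi * (real m + 1 / 2)) \<le> (central_ratio m)\<^sup>2"
    by (simp add: field_simps add_pos_nonneg)
  then have "sqrt (1 / (pi * (real m + 1 / 2))) \<le> central_ratio m"
    by (rule real_le_lsqrt[OF less_imp_le[OF central_ratio_pos]])
  then show ?thesis by (simp add: real_sqrt_divide)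
qed

text \<open>The sequence \<open>(central_ratio n)\<^sup>2 * real n\<close> increases to 1 / pi,
  which therefore bounds it.\<close>

lemma central_ratio_upper: "m > 0 \<Longrightarrow> central_ratio m \<le> 1 / sqrt (pi * real m)"
proof -
  assume m: "m > 0"
  let ?a = "\<lambda>n. (central_ratio n)\<^sup>2 * real n"
  have eq: "?a n = (real n / (2 * real n + 1)) * inverse (wallis_prod n)" for n
  proof -
    have "(central_ratio n)\<^sup>2 * (2 * real n + 1) = inverse (wallis_prod n)"
      using central_ratio_wallis[of n] wallis_prod_pos[of n] by (simp add: field_simps)
    then show ?thesis unfolding \<open>_ = inverse (wallis_prod n)\<close>[symmetric]
      by (simp add: add_nonneg_eq_0_iff)
  qed
  have "(\<lambda>n. (real n / (2 * real n + 1)) * inverse (wallis_prod n)) \<longlonglongrightarrow> (1 / 2) * inverse (pi / 2)"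
    by (intro tendsto_mult tendsto_inverse wallis[folded wallis_prod_def]) (real_asymp, simp)
  then have lim: "?a \<longlonglongrightarrow> 1 / pi" by (simp add: eq)
  have inc: "incseq ?a"
  proof (rule incseq_SucI)
    fix n
    have "real n \<le> ((2 * real n + 1) / (2 * real n + 2))\<^sup>2 * real (Suc n)"
    proof -
      have "real n * (2 * real n + 2)\<^sup>2 \<le> (2 * real n + 1)\<^sup>2 * real (Suc n)"
        by (simp add: power2_eq_square algebra_simps)
      moreover have "(2 * real n + 2)\<^sup>2 > 0" by (simp add: power2_eq_square add_nonneg_pos)
      ultimately show ?thesis by (simp add: power_divide pos_le_divide_eq)
    qed
    from mult_left_mono[OF this, of "(central_ratio n)\<^sup>2"]
    show "?a n \<le> ?a (Suc n)" by (simp add: central_ratio_Suc power_divide power_mult_distrib mult.assoc)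
  qed
  have "(central_ratio m)\<^sup>2 * real m \<le> 1 / pi" by (rule incseq_le[OF inc lim])
  then have "(central_ratio m)\<^sup>2 \<le> 1 / (pi * real m)" using m by (simp add: field_simps)
  then have "central_ratio m \<le> sqrt (1 / (pi * real m))" by (rule real_le_rsqrt)
  then show ?thesis by (simp add: real_sqrt_divide)
qed

section \<open>Falling factorials\<close>

lemma fact_div_fact_eq_prod:
  "j \<le> n \<Longrightarrow> fact n / fact (n - j) = (\<Prod>i<j. real n - real i)"
proof (induction j)
  case (Suc j)
  then have "fact (n - j) = (real n - real j) * fact (n - Suc j)"
    by (metis Suc_le_lessD Suc_le_eq fact_num_eq_if diff_Suc_eq_diff_pred diff_is_0_eq fact_reduce not_less of_nat_diff order_less_imp_le zero_less_diff diff_Suc_1 diff_commute)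
  moreover have "real n - real j \<noteq> 0" using Suc by auto
  ultimately have "fact n / fact (n - Suc j) = fact n / fact (n - j) * (real n - real j)" by simp
  then show ?case using Suc by simp
qed simp

lemma falling_fact_eq:
  assumes "j \<le> n" "n > 0"
  shows "fact n / fact (n - j) = real n ^ j * (\<Prod>i<j. 1 - real i / real n)"
proof -
  have "fact n / fact (n - j) = (\<Prod>i<j. real n * (1 - real i / real n))"
    unfolding fact_div_fact_eq_prod[OF assms(1)] using assms by (intro prod.cong) (auto simp: field_simps)
  then show ?thesis by (simp add: prod.distrib)
qed

lemma falling_fact_upper:
  assumes "j \<le> n" "n > 0"
  shows "fact n / fact (n - j) \<le> real n ^ j * exp (- (real j * (real j - 1) / (2 * real n)))"
proof -
  have s: "(\<Sum>i<j. real i) = real j * (real j - 1) / 2"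
    by (induction j) (auto simp: field_simps)
  have "(\<Prod>i<j. 1 - real i / real n) \<le> (\<Prod>i<j. exp (- (real i / real n)))"
    using assms by (intro prod_mono) (auto simp: exp_ge_one_minus_x_over_n_power_n intro: exp_ge_add_one_self[of "- _", simplified])
  also have "\<dots> = exp (- (\<Sum>i<j. real i / real n))"
    by (simp add: exp_sum flip: sum_negf)
  also have "(\<Sum>i<j. real i / real n) = real j * (real j - 1) / (2 * real n)"
    by (simp add: s flip: sum_divide_distrib)
  finally show ?thesis unfolding falling_fact_eq[OF assms] by (intro mult_left_mono) auto
qed

text \<open>While the upper bound rests on 1 - u \<le> exp(-u), this one uses ln(1 - u) \<ge> -u - 2
  u^2, valid for u \<le> 1/2; hence 2j \<le> n. With j of order sqrt n, the cubic error term in the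
  exponent tends to 0 and j^2 / (2n) survives.\<close>

lemma falling_fact_lower:
  assumes "2 * j \<le> n" "n > 0"
  shows "fact n / fact (n - j) \<ge> real n ^ j * exp (- ((real j)\<^sup>2 / (2 * real n)) - 2 * real j ^ 3 / (real n)\<^sup>2)"
proof -
  have s: "(\<Sum>i<j. real i) \<le> (real j)\<^sup>2 / 2"
    by (induction j) (auto simp: field_simps power2_eq_square)
  have s2: "(\<Sum>i<j. (real i)\<^sup>2) \<le> real j ^ 3"
  proof (induction j)
    case (Suc j)
    have "real j ^ 3 + (real j)\<^sup>2 \<le> real (Suc j) ^ 3"
      by (simp add: power2_eq_square power3_eq_cube algebra_simps)
    then show ?case using Suc by simp
  qed simp
  have "(\<Sum>i<j. real i / real n + 2 * (real i / real n)\<^sup>2)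
      = (\<Sum>i<j. real i) / real n + 2 * (\<Sum>i<j. (real i)\<^sup>2) / (real n)\<^sup>2"
    by (simp add: sum.distrib sum_divide_distrib sum_distrib_left power_divide)
  also have "\<dots> \<le> (real j)\<^sup>2 / 2 / real n + 2 * real j ^ 3 / (real n)\<^sup>2"
    by (intro add_mono divide_right_mono mult_left_mono s s2) auto
  finally have "exp (- ((real j)\<^sup>2 / (2 * real n)) - 2 * real j ^ 3 / (real n)\<^sup>2)
      \<le> exp (- (\<Sum>i<j. real i / real n + 2 * (real i / real n)\<^sup>2))" by simp
  also have "- (\<Sum>i<j. real i / real n + 2 * (real i / real n)\<^sup>2)
      = (\<Sum>i<j. - (real i / real n) - 2 * (real i / real n)\<^sup>2)"
    unfolding sum_negf[symmetric] by (rule sum.cong) auto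
  also have "exp \<dots> = (\<Prod>i<j. exp (- (real i / real n) - 2 * (real i / real n)\<^sup>2))"
    by (simp only: exp_sum finite_lessThan)
  also have "\<dots> \<le> (\<Prod>i<j. 1 - real i / real n)"
  proof (intro prod_mono conjI)
    fix i assume "i \<in> {..<j}"
    then have "real i / real n \<le> 1 / 2" using assms by (auto simp: field_simps)
    moreover have "real i / real n \<ge> 0" by simp
    ultimately have "exp (- (real i / real n) - 2 * (real i / real n)\<^sup>2) \<le> exp (ln (1 - real i / real n))"
      using ln_one_minus_pos_lower_bound[of "real i / real n"] by simp
    also have "\<dots> = 1 - real i / real n"
      using \<open>real i / real n \<le> 1 / 2\<close> by (intro exp_ln) linarith
    finally show "exp (- (real i / real n) - 2 * (real i / real n)\<^sup>2) \<le> 1 - real i / real n" .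
  qed auto
  finally show ?thesis unfolding falling_fact_eq[OF order_trans[OF _ assms(1), of j, simplified] assms(2)]
    by (intro mult_left_mono) auto
qed

text \<open>The absolute value of \<open>orthonormal_coeff \<rho> n j\<close> times
  \<open>\<rho> ^ j * fact j\<close>: free of signs and of \<rho>, see
  \<open>orthonormal_coeff_eq\<close>.\<close>

definition hermite_weight :: "nat \<Rightarrow> nat \<Rightarrow> real" where
  "hermite_weight n j = (if j \<le> n \<and> even (n + j)
     then sqrt (fact n) / (2 ^ ((n - j) div 2) * fact ((n - j) div 2)) else 0)"

lemma hermite_weight_nonneg: "hermite_weight n j \<ge> 0"
  by (simp add: hermite_weight_def)

text \<open>With n - j = 2m, multiply and divide n! / (2^m m!)^2 by (2m)!. The first factor is of
  Wallis type, the second is a falling factorial.\<close>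

lemma hermite_weight_sq:
  assumes "j \<le> n" "even (n + j)"
  shows "(hermite_weight n j)\<^sup>2 = central_ratio ((n - j) div 2) * (fact n / fact (n - j))"
proof -
  obtain m where m: "n = j + 2 * m" using assms by (metis even_add evenE le_add_diff_inverse even_diff_nat)
  have "(2::real) ^ m * 2 ^ m = 4 ^ m" by (simp flip: power_mult_distrib)
  then have "((2::real) ^ m * fact m)\<^sup>2 = 4 ^ m * (fact m)\<^sup>2"
    by (simp add: power2_eq_square mult_ac)
  then show ?thesis by (simp add: m hermite_weight_def central_ratio_def power_divide)
qed

lemma hermite_weight_sq_upper:
  assumes "j \<le> n" "even (n + j)" "n > 0"
  shows "(hermite_weight n j)\<^sup>2
    \<le> central_ratio ((n - j) div 2) * (real n ^ j * exp (- (real j * (real j - 1) / (2 * real n))))"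
  unfolding hermite_weight_sq[OF assms(1,2)]
  by (intro mult_left_mono falling_fact_upper less_imp_le[OF central_ratio_pos] assms)

text \<open>A crude bound without conditions, for rows n far below T and for indices j outside the
  window.\<close>

lemma hermite_weight_sq_le_power: "(hermite_weight n j)\<^sup>2 \<le> real n ^ j"
proof (cases "j \<le> n \<and> even (n + j)")
  case True
  have "fact n / fact (n - j) \<le> real n ^ j"
    unfolding fact_div_fact_eq_prod[OF conjunct1[OF True]]
    using prod_mono[of "{..<j}" "\<lambda>i. real n - real i" "\<lambda>_. real n"] True by simp
  then have "central_ratio ((n - j) div 2) * (fact n / fact (n - j)) \<le> 1 * real n ^ j"
    by (intro mult_mono central_ratio_le_1) auto
  then show ?thesis using True by (simp add: hermite_weight_sq)
qed (auto simp: hermite_weight_def)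

section \<open>Power sums over a parity class\<close>

lemma power_Suc_diff_bounds:
  fixes a :: real assumes "a \<ge> 0"
  shows "2 * real (Suc s) * a ^ s \<le> (a + 2) ^ Suc s - a ^ Suc s"
    and "(a + 2) ^ Suc s - a ^ Suc s \<le> 2 * real (Suc s) * (a + 2) ^ s"
proof -
  have e: "(a + 2) ^ Suc s - a ^ Suc s = 2 * (\<Sum>i<Suc s. (a + 2) ^ i * a ^ (s - i))"
    using power_diff_sumr2[of "a + 2" "Suc s" a] by (simp del: sum.lessThan_Suc power_Suc add: mult.commute)
  have "(\<Sum>i<Suc s. a ^ s) \<le> (\<Sum>i<Suc s. (a + 2) ^ i * a ^ (s - i))"
  proof (rule sum_mono)
    fix i assume "i \<in> {..<Suc s}"
    then have "a ^ s = a ^ i * a ^ (s - i)" by (simp flip: power_add)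
    also have "\<dots> \<le> (a + 2) ^ i * a ^ (s - i)" using assms by (intro mult_right_mono power_mono) auto
    finally show "a ^ s \<le> (a + 2) ^ i * a ^ (s - i)" .
  qed
  then show "2 * real (Suc s) * a ^ s \<le> (a + 2) ^ Suc s - a ^ Suc s"
    unfolding e by (simp del: sum.lessThan_Suc add: algebra_simps)
  have "(\<Sum>i<Suc s. (a + 2) ^ i * a ^ (s - i)) \<le> (\<Sum>i<Suc s. (a + 2) ^ s)"
  proof (rule sum_mono)
    fix i assume "i \<in> {..<Suc s}"
    then have "(a + 2) ^ s = (a + 2) ^ i * (a + 2) ^ (s - i)" by (simp flip: power_add)
    also have "\<dots> \<ge> (a + 2) ^ i * a ^ (s - i)" using assms by (intro mult_left_mono power_mono) auto
    finally show "(a + 2) ^ i * a ^ (s - i) \<le> (a + 2) ^ s" .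
  qed
  then show "(a + 2) ^ Suc s - a ^ Suc s \<le> 2 * real (Suc s) * (a + 2) ^ s"
    unfolding e by (simp del: sum.lessThan_Suc add: algebra_simps)
qed

lemma parity_insert:
  "{n. n \<le> Suc T \<and> even (n + p)} = (if even (Suc T + p) then insert (Suc T) {n. n \<le> T \<and> even (n + p)} else {n. n \<le> T \<and> even (n + p)})"
  by (auto simp: le_Suc_eq)

text \<open>Neighbours in a parity class differ by 2, so 2 (s + 1) n^s is compared with (n +
  2)^(s+1) - n^(s+1) and the sum telescopes.\<close>

lemma parity_power_sum_upper:
  "2 * real (Suc s) * (\<Sum>n | n \<le> T \<and> even (n + p). real n ^ s) \<le> (real T + 2) ^ Suc s"
proof -
  \<comment> \<open>The induction needs the sharper bound: if T is outside the class, its last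
    element is at most T - 1 and the telescoped sum ends at T + 1.\<close>
  have "2 * real (Suc s) * (\<Sum>n | n \<le> T \<and> even (n + p). real n ^ s)
     \<le> (if even (T + p) then (real T + 2) ^ Suc s else (real T + 1) ^ Suc s)"
  proof (induction T)
    case 0
    have "{n. n \<le> (0::nat) \<and> even (n + p)} = (if even p then {0} else {})"
      by (auto intro: odd_pos)
    moreover have "2 * real (Suc s) * 0 ^ s \<le> 2 ^ Suc s" by (cases s) auto
    ultimately show ?case by (simp del: power_Suc of_nat_Suc)
  next
    case (Suc T)
    show ?case
    proof (cases "even (Suc T + p)")
      case True
      then have "odd (T + p)" by simp
      have "2 * real (Suc s) * (\<Sum>n | n \<le> Suc T \<and> even (n + p). real n ^ s)
        = 2 * real (Suc s) * real (Suc T) ^ s + 2 * real (Suc s) * (\<Sum>n | n \<le> T \<and> even (n + p). real n ^ s)"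
        unfolding parity_insert using True by (simp add: distrib_left del: of_nat_Suc)
      also have "\<dots> \<le> ((real (Suc T) + 2) ^ Suc s - real (Suc T) ^ Suc s) + real (Suc T) ^ Suc s"
        using Suc \<open>odd (T + p)\<close> by (intro add_mono power_Suc_diff_bounds(1)) (auto simp: add.commute simp del: power_Suc)
      finally show ?thesis using True by simp
    next
      case False
      then show ?thesis using Suc unfolding parity_insert by (simp add: add.commute del: power_Suc)
    qed
  qed
  also have "\<dots> \<le> (real T + 2) ^ Suc s"
    by (split if_split, intro conjI impI order_refl) (rule power_mono, auto)
  finally show ?thesis .
qed

text \<open>The same telescoping from the other side, with n^(s+1) - (n - 2)^(s+1) \<le> 2 (s + 1)
  n^s. Positivity of T keeps the base T - 1 nonnegative.\<close>

lemma parity_power_sum_lower: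
  assumes "T > 0"
  shows "(real T - 1) ^ Suc s \<le> 2 * real (Suc s) * (\<Sum>n | n \<le> T \<and> even (n + p). real n ^ s)"
proof -
  have "(if even (T + p) then real T ^ Suc s else (real T - 1) ^ Suc s)
     \<le> 2 * real (Suc s) * (\<Sum>n | n \<le> T \<and> even (n + p). real n ^ s)"
    using assms
  proof (induction T)
    case (Suc T)
    show ?case
    proof (cases "even (Suc T + p)")
      case True
      then have "odd (T + p)" by simp
      have "real (Suc T) ^ Suc s \<le> 2 * real (Suc s) * real (Suc T) ^ s + 2 * real (Suc s) * (\<Sum>n | n \<le> T \<and> even (n + p). real n ^ s)"
      proof (cases "T = 0")
        case True
        show ?thesis unfolding True by (simp add: sum_nonneg add_increasing2)
      next
        case False
        have "real (Suc T) ^ Suc s = ((real T - 1 + 2) ^ Suc s - (real T - 1) ^ Suc s) + (real T - 1) ^ Suc s"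
          by (simp add: add.commute)
        also have "\<dots> \<le> 2 * real (Suc s) * (real T - 1 + 2) ^ s + 2 * real (Suc s) * (\<Sum>n | n \<le> T \<and> even (n + p). real n ^ s)"
          using Suc False \<open>odd (T + p)\<close> by (intro add_mono power_Suc_diff_bounds(2)) auto
        finally show ?thesis by (simp add: add.commute)
      qed
      also have "\<dots> = 2 * real (Suc s) * (\<Sum>n | n \<le> Suc T \<and> even (n + p). real n ^ s)"
        unfolding parity_insert using True by (simp add: distrib_left del: of_nat_Suc)
      finally show ?thesis using True by simp
    next
      case False
      show ?thesis
      proof (cases "T = 0")
        case True
        then show ?thesis using False by (simp add: sum_nonneg)
      next
        case T: False
        then show ?thesis using False Suc unfolding parity_insert by (simp del: power_Suc of_nat_Suc add: of_nat_Suc)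
      qed
    qed
  qed simp
  moreover have "(real T - 1) ^ Suc s \<le> (if even (T + p) then real T ^ Suc s else (real T - 1) ^ Suc s)"
    by (split if_split, intro conjI impI order_refl) (rule power_mono, use assms in auto)
  ultimately show ?thesis by linarith
qed

section \<open>Sums of Hermite weights over the rows, uniformly in a window of indices\<close>

lemma one_minus_power_le_exp:
  fixes \<delta> :: real assumes "0 \<le> \<delta>" "\<delta> \<le> 1"
  shows "(1 - \<delta>) ^ j \<le> exp (- (\<delta> * real j))"
proof -
  have "(1 - \<delta>) ^ j \<le> exp (- \<delta>) ^ j"
    using assms exp_ge_add_one_self[of "- \<delta>"] by (intro power_mono) auto
  then show ?thesis by (simp add: exp_of_nat_mult[symmetric] mult.commute)
qed

text \<open>Rows with n \<ge> (1 - \<delta>) T get the sharp bound with one constant K for all j in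
  [a, b]; \<open>big\<close> keeps n - j large there. In the lower rows, n^j \<le> T^j (1 -
  \<delta>)^j is exponentially small because j is at least a.\<close>

lemma hermite_weight_sum_upper:
  fixes T j :: nat and \<delta> a b :: real
  assumes T: "T > 0" and d: "0 < \<delta>" "\<delta> < 1" and ab: "1 \<le> a" "a \<le> real j" "real j \<le> b"
    and big: "b < (1 - \<delta>) * real T"
  shows "(\<Sum>n\<le>T. (hermite_weight n j)\<^sup>2) \<le> real T ^ j *
    (exp (- (a * (a - 1) / (2 * real T))) * (1 / sqrt (pi * (((1 - \<delta>) * real T - b) / 2))
      * (real T * exp (2 * (b + 1) / real T) / (2 * (a + 1)))) + (real T + 1) * exp (- (\<delta> * a)))"
proof -
  define K where "K = exp (- (a * (a - 1) / (2 * real T))) * (1 / sqrt (pi * (((1 - \<delta>) * real T - b) / 2)))"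
  have K0: "K \<ge> 0" using big by (simp add: K_def)
  have main: "(hermite_weight n j)\<^sup>2 \<le> K * real n ^ j"
    if n: "n \<le> T" "even (n + j)" "(1 - \<delta>) * real T \<le> real n" for n
  proof -
    have jn: "j < n" using n ab big by linarith
    define m where "m = (n - j) div 2"
    have m: "real m = (real n - real j) / 2"
      using jn n(2) unfolding m_def by (subst real_of_nat_div) (auto simp: of_nat_diff)
    have mge: "real m \<ge> ((1 - \<delta>) * real T - b) / 2" unfolding m using n ab by simp
    then have mpos: "m > 0" using big by (cases m) auto
    have "central_ratio m \<le> 1 / sqrt (pi * real m)" by (rule central_ratio_upper[OF mpos])
    also have "\<dots> \<le> 1 / sqrt (pi * (((1 - \<delta>) * real T - b) / 2))"
      using mge big by (intro divide_left_mono real_sqrt_le_mono mult_left_mono) (auto simp: mpos)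
    finally have c: "central_ratio m \<le> 1 / sqrt (pi * (((1 - \<delta>) * real T - b) / 2))" .
    have "a * (a - 1) / (2 * real T) \<le> real j * (real j - 1) / (2 * real n)"
      using ab n jn T by (intro frac_le mult_mono) auto
    then have e: "exp (- (real j * (real j - 1) / (2 * real n))) \<le> exp (- (a * (a - 1) / (2 * real T)))" by simp
    have "(hermite_weight n j)\<^sup>2 \<le> central_ratio m * (real n ^ j * exp (- (real j * (real j - 1) / (2 * real n))))"
      unfolding m_def using jn n(2) by (intro hermite_weight_sq_upper) auto
    also have "\<dots> \<le> (1 / sqrt (pi * (((1 - \<delta>) * real T - b) / 2))) * (real n ^ j * exp (- (a * (a - 1) / (2 * real T))))"
      using c e big by (intro mult_mono) (auto intro: less_imp_le[OF central_ratio_pos])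
    finally show ?thesis by (simp add: K_def mult_ac)
  qed
  \<comment> \<open>The error term is granted to every row and the main term to the whole parity
    class, so that the main part becomes a complete power sum.\<close>
  have "(\<Sum>n\<le>T. (hermite_weight n j)\<^sup>2)
      \<le> (\<Sum>n\<le>T. (if even (n + j) then K * real n ^ j else 0) + real T ^ j * exp (- (\<delta> * a)))"
  proof (rule sum_mono)
    fix n assume n: "n \<in> {..T}"
    show "(hermite_weight n j)\<^sup>2 \<le> (if even (n + j) then K * real n ^ j else 0) + real T ^ j * exp (- (\<delta> * a))"
    proof (cases "even (n + j)")
      case False
      then show ?thesis by (simp add: hermite_weight_def)
    next
      case True
      show ?thesis
      proof (cases "(1 - \<delta>) * real T \<le> real n")
        case True
        then show ?thesis using main[of n] n \<open>even (n + j)\<close> by (simp add: add_increasing2)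
      next
        case False
        have "(hermite_weight n j)\<^sup>2 \<le> real n ^ j" by (rule hermite_weight_sq_le_power)
        also have "\<dots> \<le> ((1 - \<delta>) * real T) ^ j" using False by (intro power_mono) auto
        also have "\<dots> \<le> exp (- (\<delta> * real j)) * real T ^ j"
          unfolding power_mult_distrib using d by (intro mult_right_mono one_minus_power_le_exp) auto
        also have "\<dots> \<le> exp (- (\<delta> * a)) * real T ^ j" using ab d by (intro mult_right_mono) auto
        finally show ?thesis using True K0 by (simp add: add_increasing mult.commute)
      qed
    qed
  qed
  also have "\<dots> = K * (\<Sum>n | n \<le> T \<and> even (n + j). real n ^ j) + real T ^ j * ((real T + 1) * exp (- (\<delta> * a)))"
  proof -
    have "{n \<in> {..T}. even (n + j)} = {n. n \<le> T \<and> even (n + j)}" by auto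
    then have "(\<Sum>n\<le>T. if even (n + j) then K * real n ^ j else 0) = K * (\<Sum>n | n \<le> T \<and> even (n + j). real n ^ j)"
      by (simp add: sum.inter_filter[symmetric] sum_distrib_left del: even_add)
    then show ?thesis by (simp add: sum.distrib algebra_simps del: even_add)
  qed
  finally have A: "(\<Sum>n\<le>T. (hermite_weight n j)\<^sup>2)
    \<le> K * (\<Sum>n | n \<le> T \<and> even (n + j). real n ^ j) + real T ^ j * ((real T + 1) * exp (- (\<delta> * a)))" .
  have P: "(\<Sum>n | n \<le> T \<and> even (n + j). real n ^ j) \<le> real T ^ j * (real T * exp (2 * (b + 1) / real T) / (2 * (a + 1)))"
  proof -
    have "(\<Sum>n | n \<le> T \<and> even (n + j). real n ^ j) \<le> (real T + 2) ^ Suc j / (2 * real (Suc j))"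
      using parity_power_sum_upper[of j T j] by (simp add: pos_le_divide_eq mult.commute del: power_Suc of_nat_Suc)
    also have "\<dots> \<le> (real T + 2) ^ Suc j / (2 * (a + 1))"
      using ab by (intro divide_left_mono) auto
    also have "real T + 2 = real T * (1 + 2 / real T)" using T by (simp add: field_simps)
    also have "(real T * (1 + 2 / real T)) ^ Suc j \<le> real T ^ Suc j * exp (2 * (b + 1) / real T)"
    proof -
      have "(1 + 2 / real T) ^ Suc j \<le> exp (2 / real T) ^ Suc j"
        by (intro power_mono) auto
      also have "\<dots> = exp (real (Suc j) * (2 / real T))" by (rule exp_of_nat_mult[symmetric])
      also have "\<dots> \<le> exp (2 * (b + 1) / real T)" using ab T by (simp add: divide_right_mono)
      finally show ?thesis unfolding power_mult_distrib by (intro mult_left_mono) auto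
    qed
    finally show ?thesis using ab by (simp add: divide_right_mono mult_ac)
  qed
  note A
  also have "K * (\<Sum>n | n \<le> T \<and> even (n + j). real n ^ j) + real T ^ j * ((real T + 1) * exp (- (\<delta> * a)))
      \<le> K * (real T ^ j * (real T * exp (2 * (b + 1) / real T) / (2 * (a + 1))))
        + real T ^ j * ((real T + 1) * exp (- (\<delta> * a)))"
    using P K0 by (intro add_right_mono mult_left_mono) auto
  finally show ?thesis by (simp only: K_def distrib_left mult_ac)
qed

lemma hermite_weight_lower:
  fixes T j n :: nat and \<delta> b :: real
  assumes T: "T > 0" and d: "0 < \<delta>" "\<delta> < 1" and j: "real j \<le> b"
    and big: "2 * b \<le> (1 - \<delta>) * real T" and n: "n \<le> T" "even (n + j)" "(1 - \<delta>) * real T \<le> real n"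
  shows "(hermite_weight n j)\<^sup>2 \<ge> 1 / sqrt (pi * (real T / 2 + 1 / 2)) * real n ^ j
    * exp (- (b\<^sup>2 / (2 * (1 - \<delta>) * real T)) - 2 * b ^ 3 / ((1 - \<delta>) * real T)\<^sup>2)"
proof -
  have dT: "(1 - \<delta>) * real T > 0" using d T by simp
  then have n0: "n > 0" using n by (cases n) auto
  have jn: "2 * j \<le> n" using j big n by linarith
  define m where "m = (n - j) div 2"
  have "real m \<le> real T / 2" using n unfolding m_def by linarith
  then have "1 / sqrt (pi * (real T / 2 + 1 / 2)) \<le> 1 / sqrt (pi * (real m + 1 / 2))"
    by (intro divide_left_mono real_sqrt_le_mono mult_left_mono mult_pos_pos) (auto intro: add_nonneg_pos)
  also have "\<dots> \<le> central_ratio m" by (rule central_ratio_lower)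
  finally have c: "1 / sqrt (pi * (real T / 2 + 1 / 2)) \<le> central_ratio m" .
  have "(real j)\<^sup>2 / (2 * real n) \<le> b\<^sup>2 / (2 * ((1 - \<delta>) * real T))"
    using n dT j by (intro frac_le power_mono mult_left_mono) auto
  moreover have "2 * real j ^ 3 / (real n)\<^sup>2 \<le> 2 * b ^ 3 / ((1 - \<delta>) * real T)\<^sup>2"
    using n dT j by (intro frac_le power_mono mult_left_mono) auto
  ultimately have "exp (- (b\<^sup>2 / (2 * (1 - \<delta>) * real T)) - 2 * b ^ 3 / ((1 - \<delta>) * real T)\<^sup>2)
     \<le> exp (- ((real j)\<^sup>2 / (2 * real n)) - 2 * real j ^ 3 / (real n)\<^sup>2)"
    unfolding exp_le_cancel_iff mult.assoc by linarith
  then have "real n ^ j * exp (- (b\<^sup>2 / (2 * (1 - \<delta>) * real T)) - 2 * b ^ 3 / ((1 - \<delta>) * real T)\<^sup>2)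
     \<le> real n ^ j * exp (- ((real j)\<^sup>2 / (2 * real n)) - 2 * real j ^ 3 / (real n)\<^sup>2)"
    by (intro mult_left_mono) auto
  also have "\<dots> \<le> fact n / fact (n - j)" by (rule falling_fact_lower[OF jn n0])
  finally have f: "real n ^ j * exp (- (b\<^sup>2 / (2 * (1 - \<delta>) * real T)) - 2 * b ^ 3 / ((1 - \<delta>) * real T)\<^sup>2)
     \<le> fact n / fact (n - j)" .
  have "(hermite_weight n j)\<^sup>2 = central_ratio m * (fact n / fact (n - j))"
    unfolding m_def using jn n by (intro hermite_weight_sq) auto
  also have "\<dots> \<ge> 1 / sqrt (pi * (real T / 2 + 1 / 2)) * (real n ^ j
    * exp (- (b\<^sup>2 / (2 * (1 - \<delta>) * real T)) - 2 * b ^ 3 / ((1 - \<delta>) * real T)\<^sup>2))"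
    by (intro mult_mono c f) (auto intro: less_imp_le[OF central_ratio_pos])
  finally show ?thesis by (simp only: mult.assoc)
qed

text \<open>Off-diagonal pairs are included, since the near rank-one structure must be visible in
  all entries of a block. The bound depends on j and k only through T^((j+k)/2), which is
  multiplicative in j and k.\<close>

lemma hermite_weight_sum_lower:
  fixes T j k :: nat and \<delta> a b :: real
  assumes T: "T > 0" and d: "0 < \<delta>" "\<delta> < 1" and j: "a \<le> real j" "real j \<le> b" and k: "a \<le> real k" "real k \<le> b"
    and jk: "even (j + k)" and big: "2 * b \<le> (1 - \<delta>) * real T"
  shows "(\<Sum>n\<le>T. hermite_weight n j * hermite_weight n k) \<ge> real T ^ ((j + k) div 2) *
    (exp (- (b\<^sup>2 / (2 * (1 - \<delta>) * real T)) - 2 * b ^ 3 / ((1 - \<delta>) * real T)\<^sup>2) *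
     (1 / sqrt (pi * (real T / 2 + 1 / 2)) *
      ((real T - 1) * (1 - b / real T) / (2 * (b + 1)) - (real T + 1) * exp (- (\<delta> * a)))))"
proof -
  define s where "s = (j + k) div 2"
  have jks: "j + k = 2 * s" using jk by (auto simp: s_def)
  define K where "K = exp (- (b\<^sup>2 / (2 * (1 - \<delta>) * real T)) - 2 * b ^ 3 / ((1 - \<delta>) * real T)\<^sup>2)
     * (1 / sqrt (pi * (real T / 2 + 1 / 2)))"
  have K0: "K \<ge> 0" by (simp add: K_def)
  have sb: "real s \<le> b" "a \<le> real s" using j k jks by linarith+
  have b0: "b \<ge> 0" using sb by linarith
  have bT: "b \<le> real T" 
  proof -
    have "(1 - \<delta>) * real T \<le> 1 * real T" using d by (intro mult_right_mono) auto
    then show ?thesis using big b0 by linarith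
  qed
  have main: "hermite_weight n j * hermite_weight n k \<ge> K * real n ^ s"
    if n: "n \<le> T" "even (n + j)" "(1 - \<delta>) * real T \<le> real n" for n
  proof -
    have "even (n + k)" using n(2) jk by auto
    have 1: "K * real n ^ j \<le> (hermite_weight n j)\<^sup>2"
      using hermite_weight_lower[OF T d j(2) big n] by (simp add: K_def mult_ac)
    have 2: "K * real n ^ k \<le> (hermite_weight n k)\<^sup>2"
      using hermite_weight_lower[OF T d k(2) big n(1) \<open>even (n + k)\<close> n(3)] by (simp add: K_def mult_ac)
    \<comment> \<open>The bounds for the two squares multiply to a perfect square, because s is the
      mean of j and k.\<close>
    have "(K * real n ^ s)\<^sup>2 = (K * real n ^ j) * (K * real n ^ k)"
    proof -
      have "(real n ^ s)\<^sup>2 = real n ^ (j + k)" unfolding jks by (simp add: power_mult[symmetric] mult.commute)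
      then show ?thesis by (simp add: power_mult_distrib power_add power2_eq_square mult_ac)
    qed
    also have "\<dots> \<le> (hermite_weight n j)\<^sup>2 * (hermite_weight n k)\<^sup>2"
      using 1 2 K0 by (intro mult_mono) auto
    finally have "(K * real n ^ s)\<^sup>2 \<le> (hermite_weight n j * hermite_weight n k)\<^sup>2"
      by (simp add: power_mult_distrib)
    then show ?thesis
      by (rule power2_le_imp_le) (auto intro: mult_nonneg_nonneg hermite_weight_nonneg)
  qed
  have "K * ((\<Sum>n | n \<le> T \<and> even (n + j). real n ^ s) - (real T + 1) * (real T ^ s * exp (- (\<delta> * a))))
      = (\<Sum>n\<le>T. (if even (n + j) then K * real n ^ s else 0) - K * (real T ^ s * exp (- (\<delta> * a))))"
  proof -
    have "{n \<in> {..T}. even (n + j)} = {n. n \<le> T \<and> even (n + j)}" by auto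
    then have "(\<Sum>n\<le>T. if even (n + j) then K * real n ^ s else 0) = K * (\<Sum>n | n \<le> T \<and> even (n + j). real n ^ s)"
      by (simp add: sum.inter_filter[symmetric] sum_distrib_left del: even_add)
    then show ?thesis by (simp add: sum_subtractf algebra_simps del: even_add)
  qed
  \<comment> \<open>In rows below the threshold the main term is at most the subtracted error, so
    the left side is nonpositive and nonnegativity of the weights suffices.\<close>
  also have "\<dots> \<le> (\<Sum>n\<le>T. hermite_weight n j * hermite_weight n k)"
  proof (rule sum_mono)
    fix n assume n: "n \<in> {..T}"
    have nn: "hermite_weight n j * hermite_weight n k \<ge> 0"
      by (intro mult_nonneg_nonneg hermite_weight_nonneg)
    have pp: "K * (real T ^ s * exp (- (\<delta> * a))) \<ge> 0" using K0 by simp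
    show "(if even (n + j) then K * real n ^ s else 0) - K * (real T ^ s * exp (- (\<delta> * a)))
      \<le> hermite_weight n j * hermite_weight n k"
    proof (cases "even (n + j) \<and> (1 - \<delta>) * real T > real n")
      case True
      have "real n ^ s \<le> ((1 - \<delta>) * real T) ^ s" using True by (intro power_mono) auto
      also have "\<dots> \<le> exp (- (\<delta> * real s)) * real T ^ s"
        unfolding power_mult_distrib using d by (intro mult_right_mono one_minus_power_le_exp) auto
      also have "\<dots> \<le> exp (- (\<delta> * a)) * real T ^ s" using sb d by (intro mult_right_mono) auto
      finally have "K * real n ^ s \<le> K * (real T ^ s * exp (- (\<delta> * a)))"
        using K0 by (intro mult_left_mono) (auto simp: mult.commute)
      then show ?thesis using nn True by auto
    next
      case False
      show ?thesis
      proof (cases "even (n + j)")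
        case True
        then have "K * real n ^ s \<le> hermite_weight n j * hermite_weight n k"
          using False n by (intro main) auto
        then show ?thesis using True pp by simp
      qed (use nn pp in simp)
    qed
  qed
  finally have A: "K * ((\<Sum>n | n \<le> T \<and> even (n + j). real n ^ s) - (real T + 1) * (real T ^ s * exp (- (\<delta> * a))))
     \<le> (\<Sum>n\<le>T. hermite_weight n j * hermite_weight n k)" .
  have "real T ^ s * ((real T - 1) * (1 - b / real T) / (2 * (b + 1))) \<le> (\<Sum>n | n \<le> T \<and> even (n + j). real n ^ s)"
  proof -
    have "1 - b / real T \<le> 1 + real s * (- 1 / real T)" using sb T by (simp add: divide_right_mono)
    also have "\<dots> \<le> (1 + (- 1 / real T)) ^ s" by (rule Bernoulli_inequality) (use T in auto)
    finally have B: "1 - b / real T \<le> (1 - 1 / real T) ^ s" by simp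
    have "real T ^ s * ((real T - 1) * (1 - b / real T) / (2 * (b + 1)))
       \<le> real T ^ s * ((real T - 1) * (1 - 1 / real T) ^ s / (2 * real (Suc s)))"
      using B sb b0 T bT by (intro mult_left_mono frac_le mult_nonneg_nonneg) auto
    also have "\<dots> = (real T - 1) ^ Suc s / (2 * real (Suc s))"
    proof -
      have "real T ^ s * (1 - 1 / real T) ^ s = (real T - 1) ^ s"
        using T by (simp add: power_mult_distrib[symmetric] right_diff_distrib)
      then show ?thesis by (simp add: mult_ac del: of_nat_Suc)
    qed
    also have "\<dots> \<le> (\<Sum>n | n \<le> T \<and> even (n + j). real n ^ s)"
      using parity_power_sum_lower[OF T, of s j] by (simp add: pos_divide_le_eq mult.commute del: power_Suc of_nat_Suc)
    finally show ?thesis .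
  qed
  then have "K * (real T ^ s * ((real T - 1) * (1 - b / real T) / (2 * (b + 1)))
      - (real T + 1) * (real T ^ s * exp (- (\<delta> * a))))
     \<le> K * ((\<Sum>n | n \<le> T \<and> even (n + j). real n ^ s) - (real T + 1) * (real T ^ s * exp (- (\<delta> * a))))"
    using K0 by (intro mult_left_mono) auto
  also note A
  finally show ?thesis unfolding s_def[symmetric] K_def by (simp only: mult_ac right_diff_distrib)
qed

section \<open>Block traces\<close>

definition exp_even_term :: "real \<Rightarrow> nat \<Rightarrow> real" where
  "exp_even_term x j = (2 * x) ^ (2 * j) / fact (2 * j)"

lemma exp_even_term_nonneg: "exp_even_term x j \<ge> 0"
  by (simp add: exp_even_term_def power_mult)

lemma power_div_fact_sq: "(x ^ j / fact j)\<^sup>2 = central_ratio j * exp_even_term x j"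
proof -
  have "(2 * x) ^ (2 * j) = (4 * x\<^sup>2) ^ j" by (simp add: power_mult power_mult_distrib)
  also have "\<dots> = 4 ^ j * (x ^ j)\<^sup>2" by (simp add: power_mult_distrib mult.commute flip: power_mult)
  finally have "(2 * x) ^ (2 * j) = 4 ^ j * (x ^ j)\<^sup>2" .
  then show ?thesis
    by (simp add: central_ratio_def exp_even_term_def power_divide)
qed

lemma exp_even_term_sums_cosh: "exp_even_term x sums cosh (2 * x)"
proof -
  have "(\<lambda>n. if even n then (2 * x) ^ n /\<^sub>R fact n else 0) sums cosh (2 * x)"
    by (rule cosh_converges)
  from sums_group[OF this, of 2]
  have "(\<lambda>n. sum (\<lambda>n. if even n then (2 * x) ^ n /\<^sub>R fact n else 0) {n * 2..<n * 2 + 2}) sums cosh (2 * x)"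
    by simp
  moreover have "{n * 2..<n * 2 + 2} = {2 * n, Suc (2 * n)}" for n :: nat by auto
  ultimately show ?thesis
    by (simp add: exp_even_term_def[abs_def] scaleR_conv_of_real field_simps)
qed

text \<open>The cosine series has the same terms with signs (-1)^j, so adding it with sign (-1)^p
  cancels the wrong parity. As cos is bounded, both classes carry exp(2x) / 4 to leading
  order.\<close>

lemma exp_even_term_parity_sums:
  "(\<lambda>j. if even (j + p) then exp_even_term x j else 0) sums ((cosh (2 * x) + (- 1) ^ p * cos (2 * x)) / 2)"
proof -
  have "(\<lambda>j. (exp_even_term x j + (- 1) ^ p * ((- 1) ^ j / fact (2 * j) * (2 * x) ^ (2 * j))) / 2)
      sums ((cosh (2 * x) + (- 1) ^ p * cos (2 * x)) / 2)"
    by (intro sums_divide sums_add exp_even_term_sums_cosh sums_mult cos_paired)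
  moreover have "(exp_even_term x j + (- 1) ^ p * ((- 1) ^ j / fact (2 * j) * (2 * x) ^ (2 * j))) / 2
      = (if even (j + p) then exp_even_term x j else 0)" for j
  proof -
    have "(- 1) ^ p * ((- 1) ^ j / fact (2 * j) * (2 * x) ^ (2 * j)) = (- 1) ^ (j + p) * exp_even_term x j"
      by (simp add: exp_even_term_def power_add)
    then show ?thesis by (cases "even (j + p)") (simp_all only: neg_one_even_power neg_one_odd_power if_True if_False, simp_all)
  qed
  ultimately show ?thesis by simp
qed

lemma sum_le_of_sums:
  fixes f :: "nat \<Rightarrow> real"
  assumes "f sums s" "\<And>j. f j \<ge> 0" "finite F"
  shows "sum f F \<le> s"
  using sum_le_suminf[of f F] assms sums_summable sums_unique by metis

lemma exp_even_parity_upper: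
  assumes "x \<ge> 0" "finite F" "\<And>j. j \<in> F \<Longrightarrow> even (j + p)"
  shows "sum (exp_even_term x) F \<le> exp (2 * x) / 4 + 1"
proof -
  have "sum (exp_even_term x) F = (\<Sum>j\<in>F. if even (j + p) then exp_even_term x j else 0)"
    using assms(3) by (intro sum.cong) auto
  also have "\<dots> \<le> (cosh (2 * x) + (- 1) ^ p * cos (2 * x)) / 2"
    by (rule sum_le_of_sums[OF exp_even_term_parity_sums]) (auto simp: exp_even_term_nonneg assms(2))
  also have "\<dots> \<le> (cosh (2 * x) + 1) / 2"
  proof -
    have "\<bar>(- 1) ^ p * cos (2 * x)\<bar> \<le> 1" by (simp add: abs_mult power_abs)
    then show ?thesis by (simp add: abs_le_iff)
  qed
  also have "\<dots> \<le> exp (2 * x) / 4 + 1"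
  proof -
    have "exp (- (2 * x)) \<le> 1" using assms(1) by simp
    then have "exp (2 * x) + exp (- (2 * x)) \<le> exp (2 * x) + 2" by linarith
    then show ?thesis by (simp add: cosh_def)
  qed
  finally show ?thesis .
qed

text \<open>Bounds for the right and the left tail, c = 1 + \<delta> and c = 1 - \<delta>. For small
  \<delta>, c (1 - ln c) is about 1 - \<delta>^2 / 2, so the tail is smaller than exp(2x) by a
  factor of about exp(-\<delta>^2 x).\<close>

definition chernoff_tail :: "real \<Rightarrow> real \<Rightarrow> real" where
  "chernoff_tail x \<delta> = exp ((1 + \<delta>) * (2 * x) * (1 - ln (1 + \<delta>))) + exp ((1 - \<delta>) * (2 * x) * (1 - ln (1 - \<delta>)))"

text \<open>Exponential tilting: replacing x by c x multiplies the j-th term by c^(2j), which is at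
  least c^(2 c x) on F. Writing the condition with ln c covers the right tail (c > 1) and the left
  tail (c < 1) at once.\<close>

lemma chernoff_sum_bound:
  assumes x: "x \<ge> 0" and c: "c > 0" and F: "finite F"
    and far: "\<And>j. j \<in> F \<Longrightarrow> c * x * ln c \<le> real j * ln c"
  shows "sum (exp_even_term x) F \<le> exp (c * (2 * x) * (1 - ln c))"
proof -
  have "sum (exp_even_term x) F \<le> (\<Sum>j\<in>F. exp (- (c * (2 * x) * ln c)) * exp_even_term (c * x) j)"
  proof (rule sum_mono)
    fix j assume "j \<in> F"
    have "c ^ (2 * j) = exp (ln c * real (2 * j))"
      by (subst exp_of_nat2_mult) (simp add: c)
    also have "\<dots> \<ge> exp (c * (2 * x) * ln c)" using far[OF \<open>j \<in> F\<close>] by (simp add: mult_ac)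
    finally have "1 \<le> exp (- (c * (2 * x) * ln c)) * c ^ (2 * j)"
      by (simp add: exp_minus field_simps)
    from mult_right_mono[OF this exp_even_term_nonneg[of x j]]
    have "exp_even_term x j \<le> exp (- (c * (2 * x) * ln c)) * (c ^ (2 * j) * exp_even_term x j)" by (simp add: mult.assoc)
    also have "c ^ (2 * j) * exp_even_term x j = exp_even_term (c * x) j"
      by (simp add: exp_even_term_def power_mult_distrib)
    finally show "exp_even_term x j \<le> exp (- (c * (2 * x) * ln c)) * exp_even_term (c * x) j" .
  qed
  also have "\<dots> \<le> exp (- (c * (2 * x) * ln c)) * cosh (2 * (c * x))"
    unfolding sum_distrib_left[symmetric]
    by (intro mult_left_mono sum_le_of_sums[OF exp_even_term_sums_cosh] exp_even_term_nonneg F) auto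
  also have "\<dots> \<le> exp (- (c * (2 * x) * ln c)) * exp (2 * (c * x))"
    using x c by (intro mult_left_mono) (auto simp: cosh_def)
  also have "\<dots> = exp (c * (2 * x) * (1 - ln c))"
    by (simp add: exp_add[symmetric] algebra_simps)
  finally show ?thesis .
qed

lemma exp_even_tail_upper:
  assumes x: "x \<ge> 0" and d: "0 < \<delta>" "\<delta> < 1" and F: "finite F"
    and far: "\<And>j. j \<in> F \<Longrightarrow> real j < (1 - \<delta>) * x \<or> (1 + \<delta>) * x < real j"
  shows "sum (exp_even_term x) F \<le> chernoff_tail x \<delta>"
proof -
  let ?A = "{j \<in> F. (1 + \<delta>) * x < real j}" and ?B = "{j \<in> F. real j < (1 - \<delta>) * x}"
  have "sum (exp_even_term x) F \<le> sum (exp_even_term x) (?A \<union> ?B)"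
    using far F by (intro sum_mono2) (auto simp: exp_even_term_nonneg)
  also have "\<dots> \<le> sum (exp_even_term x) ?A + sum (exp_even_term x) ?B"
    using F sum.union_inter[of ?A ?B "exp_even_term x"] sum_nonneg[of "?A \<inter> ?B" "exp_even_term x"]
    by (simp add: exp_even_term_nonneg)
  also have "sum (exp_even_term x) ?A \<le> exp ((1 + \<delta>) * (2 * x) * (1 - ln (1 + \<delta>)))"
    using x d F by (intro chernoff_sum_bound mult_right_mono) auto
  also have "sum (exp_even_term x) ?B \<le> exp ((1 - \<delta>) * (2 * x) * (1 - ln (1 - \<delta>)))"
    using x d F by (intro chernoff_sum_bound mult_right_mono_neg) auto
  finally show ?thesis by (simp add: chernoff_tail_def)
qed

text \<open>Terms of the parity class that are missing from F lie in the two tails; the estimate for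
  partial sums passes to the limit.\<close>

lemma exp_even_parity_lower:
  assumes x: "x \<ge> 0" and d: "0 < \<delta>" "\<delta> < 1"
    and F: "finite F" "\<And>j. even (j + p) \<Longrightarrow> (1 - \<delta>) * x \<le> real j \<Longrightarrow> real j \<le> (1 + \<delta>) * x \<Longrightarrow> j \<in> F"
  shows "exp (2 * x) / 4 - 1 - chernoff_tail x \<delta> \<le> sum (exp_even_term x) F"
proof -
  let ?f = "\<lambda>j. if even (j + p) then exp_even_term x j else 0"
  let ?s = "(cosh (2 * x) + (- 1) ^ p * cos (2 * x)) / 2"
  have "?s \<le> sum (exp_even_term x) F + chernoff_tail x \<delta>"
  proof (rule LIMSEQ_le_const2)
    show "(\<lambda>N. sum ?f {..<N}) \<longlonglongrightarrow> ?s" using exp_even_term_parity_sums by (simp only: sums_def)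
    show "\<exists>N. \<forall>n\<ge>N. sum ?f {..<n} \<le> sum (exp_even_term x) F + chernoff_tail x \<delta>"
    proof (intro exI[of _ 0] allI impI)
      fix n :: nat
      have "sum ?f {..<n} = sum ?f ({..<n} \<inter> F) + sum ?f ({..<n} - F)"
        by (subst sum.Int_Diff[of _ _ F]) auto
      also have "sum ?f ({..<n} \<inter> F) \<le> sum (exp_even_term x) ({..<n} \<inter> F)"
        by (intro sum_mono) (auto simp: exp_even_term_nonneg)
      also have "\<dots> \<le> sum (exp_even_term x) F"
        using F(1) by (intro sum_mono2) (auto simp: exp_even_term_nonneg)
      also have "sum ?f ({..<n} - F) = sum (exp_even_term x) {j \<in> {..<n} - F. even (j + p)}"
        by (subst sum.inter_filter) auto
      also have "\<dots> \<le> chernoff_tail x \<delta>"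
      proof (rule exp_even_tail_upper[OF x d])
        fix j assume "j \<in> {j \<in> {..<n} - F. even (j + p)}"
        then have "j \<notin> F" "even (j + p)" by auto
        then show "real j < (1 - \<delta>) * x \<or> (1 + \<delta>) * x < real j"
          using F(2)[of j] by linarith
      qed simp
      finally show "sum ?f {..<n} \<le> sum (exp_even_term x) F + chernoff_tail x \<delta>" by simp
    qed
  qed
  moreover have "exp (2 * x) / 4 - 1 \<le> ?s"
  proof -
    have "\<bar>(- 1) ^ p * cos (2 * x)\<bar> \<le> 1" by (simp add: abs_mult power_abs)
    moreover have "cosh (2 * x) \<ge> exp (2 * x) / 2" by (simp add: cosh_def)
    ultimately show ?thesis by (simp add: abs_le_iff)
  qed
  ultimately show ?thesis by linarith
qed

text \<open>
  The indices \<open>j\<close> that matter are those with \<open>\<bar>j - x\<bar> \<le> x * width x\<close>. The exponent \<open>- 1 / 4\<close> lies strictly between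
  \<open>- 1 / 2\<close>, which is needed for the mass outside to decay faster than any power of \<open>x\<close>, and \<open>0\<close>, which makes all
  error factors inside tend to \<open>1\<close>.
\<close>

definition width :: "real \<Rightarrow> real" where "width x = x powr (- 1 / 4)"
definition win_lo :: "real \<Rightarrow> real" where "win_lo x = (1 - width x) * x"
definition win_hi :: "real \<Rightarrow> real" where "win_hi x = (1 + width x) * x"

text \<open>\<open>upper_factor\<close> and \<open>lower_factor\<close> are the factors beside the
  power of T in the two row-sum bounds, at \<delta> = \<open>width x\<close>, a =
  \<open>win_lo x\<close>, b = \<open>win_hi x\<close>. They take a real argument t so that the
  limit can be taken along real x with t = \<rho>^2 x^2.\<close>

definition upper_factor :: "real \<Rightarrow> real \<Rightarrow> real" where
  "upper_factor t x =
    exp (- (win_lo x * (win_lo x - 1) / (2 * t))) * (1 / sqrt (pi * (((1 - width x) * t - win_hi x) / 2))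
      * (t * exp (2 * (win_hi x + 1) / t) / (2 * (win_lo x + 1)))) + (t + 1) * exp (- (width x * win_lo x))"

definition lower_factor :: "real \<Rightarrow> real \<Rightarrow> real" where
  "lower_factor t x =
    exp (- ((win_hi x)\<^sup>2 / (2 * (1 - width x) * t)) - 2 * win_hi x ^ 3 / ((1 - width x) * t)\<^sup>2) *
     (1 / sqrt (pi * (t / 2 + 1 / 2)) *
      ((t - 1) * (1 - win_hi x / t) / (2 * (win_hi x + 1)) - (t + 1) * exp (- (width x * win_lo x))))"

definition upper_mass :: "real \<Rightarrow> real" where
  "upper_mass x = 1 / sqrt (pi * win_lo x) * (exp (2 * x) / 4 + 1)"

definition lower_mass :: "real \<Rightarrow> real" where
  "lower_mass x = 1 / sqrt (pi * (win_hi x + 1 / 2)) * (exp (2 * x) / 4 - 1 - chernoff_tail x (width x))"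

text \<open>The parity share exp(2x) / 4 of cosh 2x, times the value 1 / sqrt(pi x) of the central
  ratio near index x.\<close>

definition main_mass :: "real \<Rightarrow> real" where
  "main_mass x = exp (2 * x) / (4 * sqrt (pi * x))"

lemmas window_defs = width_def win_lo_def win_hi_def

text \<open>The constant g: the central ratio near T / 2, about sqrt(2 / (pi T)); the parity power
  sum T^(j+1) / (2j) at j near sqrt T / \<rho>, which is T^j \<rho> sqrt T / 2; and the limit of
  exp(-j^2 / (2T)).\<close>

definition limit_factor :: "real \<Rightarrow> real" where
  "limit_factor \<rho> = sqrt (2 / pi) * (\<rho> / 2) * exp (- 1 / (2 * \<rho>\<^sup>2))"

lemma limit_factor_alt:
  assumes "\<rho> > 0"
  shows "exp (- (inverse (\<rho>\<^sup>2) / 2)) * (inverse ((pi * \<rho>\<^sup>2 / 2) powr (1 / 2)) * \<rho>\<^sup>2) / 2 = limit_factor \<rho>"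
proof -
  have "(pi * \<rho>\<^sup>2 / 2) powr (1 / 2) = \<rho> * sqrt (pi / 2)"
    using assms by (simp add: powr_half_sqrt real_sqrt_mult real_sqrt_divide)
  then show ?thesis
    using assms unfolding limit_factor_def by (simp add: real_sqrt_divide field_simps power2_eq_square)
qed

lemma upper_factor_limit:
  assumes "\<rho> > 0"
  shows "((\<lambda>x. upper_factor (\<rho>\<^sup>2 * x\<^sup>2) x) \<longlongrightarrow> limit_factor \<rho>) at_top"
  unfolding upper_factor_def window_defs limit_factor_alt[OF assms, symmetric]
  using assms by real_asymp

lemma lower_factor_limit:
  assumes "\<rho> > 0"
  shows "((\<lambda>x. lower_factor (\<rho>\<^sup>2 * x\<^sup>2) x) \<longlongrightarrow> limit_factor \<rho>) at_top"
  unfolding lower_factor_def window_defs limit_factor_alt[OF assms, symmetric]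
  using assms by real_asymp

lemma upper_mass_limit: "((\<lambda>x. upper_mass x / main_mass x) \<longlongrightarrow> 1) at_top"
  unfolding upper_mass_def main_mass_def window_defs by real_asymp

lemma chernoff_tail_limit:
  assumes "\<rho> > 0"
  shows "((\<lambda>x. (\<rho>\<^sup>2 * x\<^sup>2 + 1) * chernoff_tail x (width x) / main_mass x) \<longlongrightarrow> 0) at_top"
  unfolding chernoff_tail_def main_mass_def window_defs using assms by real_asymp

lemma lower_mass_limit: "((\<lambda>x. lower_mass x / main_mass x) \<longlongrightarrow> 1) at_top"
  unfolding lower_mass_def chernoff_tail_def main_mass_def window_defs by real_asymp

lemma window_eventually:
  assumes "\<rho> > 0"
  shows "eventually (\<lambda>x. x > 0 \<and> 0 < width x \<and> width x < 1 \<and> 1 \<le> win_lo x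
     \<and> 2 * win_hi x \<le> (1 - width x) * (\<rho>\<^sup>2 * x\<^sup>2)) at_top"
proof -
  have "eventually (\<lambda>x. 0 < width x) at_top" unfolding window_defs by real_asymp
  moreover have "eventually (\<lambda>x. width x < 1) at_top" unfolding window_defs by real_asymp
  moreover have "eventually (\<lambda>x. 1 \<le> win_lo x) at_top" unfolding window_defs by real_asymp
  moreover have "eventually (\<lambda>x. 2 * win_hi x \<le> (1 - width x) * (\<rho>\<^sup>2 * x\<^sup>2)) at_top"
    unfolding window_defs using assms by real_asymp
  ultimately show ?thesis using eventually_gt_at_top[of 0] by eventually_elim auto
qed

section \<open>From Hermite weights to entries of the inverse\<close>

lemma orthonormal_coeff_eq:
  assumes "\<rho> > 0"
  shows "orthonormal_coeff \<rho> n j = (- 1) ^ ((n - j) div 2) * hermite_weight n j / (\<rho> ^ j * fact j)"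
proof (cases "j \<le> n \<and> even (n + j)")
  case True
  then obtain m where m: "n = j + 2 * m"
    by (metis even_add evenE le_add_diff_inverse even_diff_nat)
  define f :: real where "f = fact n"
  have f: "f = sqrt f * sqrt f" "f > 0" by (simp_all add: f_def)
  have "orthonormal_coeff \<rho> n j = (- 1) ^ m * \<rho> ^ (2 * m) * f / (fact m * fact j * 2 ^ m) / (\<rho> ^ n * sqrt f)"
    unfolding orthonormal_coeff_def f_def m coeff_hermite power_minus[of "\<rho>\<^sup>2"] power_mult by simp
  also have "\<dots> = (- 1) ^ m * (f / sqrt f) / (fact m * fact j * 2 ^ m) * (\<rho> ^ (2 * m) / \<rho> ^ n)"
    by (simp add: mult_ac)
  also have "f / sqrt f = sqrt f" using f by (simp add: real_div_sqrt)
  also have "\<rho> ^ (2 * m) / \<rho> ^ n = 1 / \<rho> ^ j" using assms by (simp add: m power_add)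
  finally show ?thesis using True unfolding hermite_weight_def f_def by (simp add: m mult_ac)
next
  case False
  then have "coeff (hermite \<rho> n) j = 0" using coeff_hermite_eq_0 coeff_hermite_parity by auto
  then show ?thesis using False by (auto simp: orthonormal_coeff_def hermite_weight_def)
qed

text \<open>If n = j + 2m = k + 2m', then m + m' = n - (j + k) / 2, and n has the parity of j. The
  sign is therefore the same for all rows n and can be taken out of the sum.\<close>

lemma inv_hankel_eq:
  assumes "\<rho> > 0" "even (j + k)"
  shows "inv_hankel \<rho> T j k = (- 1) ^ (j + (j + k) div 2) * (\<Sum>n\<le>T. hermite_weight n j * hermite_weight n k)
     / (\<rho> ^ j * fact j * (\<rho> ^ k * fact k))"
proof -
  have "orthonormal_coeff \<rho> n j * orthonormal_coeff \<rho> n k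
      = (- 1) ^ (j + (j + k) div 2) * (hermite_weight n j * hermite_weight n k) / (\<rho> ^ j * fact j * (\<rho> ^ k * fact k))" for n
  proof (cases "j \<le> n \<and> k \<le> n \<and> even (n + j)")
    case True
    then obtain m m' where m: "n = j + 2 * m" "n = k + 2 * m'"
      using assms(2) by (metis even_add evenE le_add_diff_inverse even_diff_nat)
    have "even (m + m') = even (j + (j + k) div 2)" using m by presburger
    then have "(- 1 :: real) ^ m * (- 1) ^ m' = (- 1) ^ (j + (j + k) div 2)"
      unfolding power_add[symmetric] by (simp only: minus_one_power_iff)
    moreover have "(n - j) div 2 = m" "(n - k) div 2 = m'" using m by auto
    ultimately show ?thesis
      unfolding orthonormal_coeff_eq[OF assms(1)] by (simp add: mult_ac del: power_add)
  next
    case False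
    then have "hermite_weight n j = 0 \<or> hermite_weight n k = 0"
      using assms(2) by (auto simp: hermite_weight_def)
    then show ?thesis unfolding orthonormal_coeff_eq[OF assms(1)] by auto
  qed
  then show ?thesis by (simp add: inv_hankel_def sum_distrib_left sum_divide_distrib)
qed

lemma inv_hankel_diag_eq:
  assumes "\<rho> > 0"
  shows "inv_hankel \<rho> T j j = (\<Sum>n\<le>T. (hermite_weight n j)\<^sup>2) / (\<rho> ^ j * fact j)\<^sup>2"
  using inv_hankel_eq[OF assms, of j j T] by (simp add: power2_eq_square)

section \<open>Block traces and the sum of squared entries at a fixed T\<close>

context
  fixes \<rho> :: real and T :: nat and x :: real
  assumes rho: "\<rho> > 0" and T: "T > 0" and x: "x = sqrt (real T) / \<rho>"
    and wd: "0 < width x" "width x < 1" and lo: "1 \<le> win_lo x"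
    and big: "2 * win_hi x \<le> (1 - width x) * real T"
begin

lemma scale_pos: "x > 0" using rho T x by simp

lemma scale_sq: "real T = \<rho>\<^sup>2 * x\<^sup>2"
  using rho by (simp add: x power_divide)

lemma win_lo_le_hi: "win_lo x \<le> win_hi x"
  using wd scale_pos unfolding win_lo_def win_hi_def by (intro mult_right_mono) auto

text \<open>The identity that dictates the choice of x.\<close>

lemma scaled_power: "real T ^ j / (\<rho> ^ j * fact j)\<^sup>2 = (x ^ j / fact j)\<^sup>2"
  using rho by (simp add: scale_sq power_mult_distrib power_divide flip: power_mult) (simp add: mult.commute)

text \<open>Inside the window the sharp row-sum bound applies. Outside, each of the T + 1 rows
  contributes at most T^j, a polynomial loss that the tail estimate absorbs.\<close>

lemma parity_trace_upper:
  "parity_trace \<rho> T p \<le> upper_factor (real T) x * upper_mass x + (real T + 1) * chernoff_tail x (width x)"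
proof -
  let ?W = "{j. j \<le> T \<and> even (j + p) \<and> win_lo x \<le> real j \<and> real j \<le> win_hi x}"
  let ?O = "{j. j \<le> T \<and> even (j + p) \<and> \<not> (win_lo x \<le> real j \<and> real j \<le> win_hi x)}"
  have fin: "finite ?W" "finite ?O" by auto
  have "{j. j \<le> T \<and> even (j + p)} = ?W \<union> ?O" by auto
  then have "parity_trace \<rho> T p = sum (\<lambda>j. inv_hankel \<rho> T j j) ?W + sum (\<lambda>j. inv_hankel \<rho> T j j) ?O"
    unfolding parity_trace_def by (simp only:) (rule sum.union_disjoint[OF fin], auto)
  also have "sum (\<lambda>j. inv_hankel \<rho> T j j) ?W \<le> (\<Sum>j\<in>?W. upper_factor (real T) x * (1 / sqrt (pi * win_lo x) * exp_even_term x j))"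
  proof (rule sum_mono)
    fix j assume "j \<in> ?W"
    then have j: "win_lo x \<le> real j" "real j \<le> win_hi x" by auto
    have "win_hi x < (1 - width x) * real T" using big lo win_lo_le_hi by linarith
    then have "(\<Sum>n\<le>T. (hermite_weight n j)\<^sup>2) \<le> real T ^ j * upper_factor (real T) x"
      unfolding upper_factor_def by (intro hermite_weight_sum_upper T wd lo j)
    then have "inv_hankel \<rho> T j j \<le> real T ^ j * upper_factor (real T) x / (\<rho> ^ j * fact j)\<^sup>2"
      unfolding inv_hankel_diag_eq[OF rho] by (rule divide_right_mono) simp
    also have "\<dots> = upper_factor (real T) x * (x ^ j / fact j)\<^sup>2"
      unfolding scaled_power[symmetric] by simp
    also have "\<dots> \<le> upper_factor (real T) x * (1 / sqrt (pi * win_lo x) * exp_even_term x j)"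
    proof (intro mult_left_mono)
      have j0: "j > 0" using j lo by (cases j) auto
      have "central_ratio j \<le> 1 / sqrt (pi * real j)" by (rule central_ratio_upper[OF j0])
      also have "\<dots> \<le> 1 / sqrt (pi * win_lo x)"
        using j lo j0 by (intro divide_left_mono real_sqrt_le_mono mult_left_mono) auto
      finally show "(x ^ j / fact j)\<^sup>2 \<le> 1 / sqrt (pi * win_lo x) * exp_even_term x j"
        unfolding power_div_fact_sq by (intro mult_right_mono exp_even_term_nonneg)
      show "upper_factor (real T) x \<ge> 0"
        unfolding upper_factor_def using big lo win_lo_le_hi by (intro add_nonneg_nonneg mult_nonneg_nonneg) auto
    qed
    finally show "inv_hankel \<rho> T j j \<le> upper_factor (real T) x * (1 / sqrt (pi * win_lo x) * exp_even_term x j)" .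
  qed
  also have "\<dots> = upper_factor (real T) x * (1 / sqrt (pi * win_lo x)) * sum (exp_even_term x) ?W"
    by (simp add: sum_distrib_left mult.assoc)
  also have "\<dots> \<le> upper_factor (real T) x * (1 / sqrt (pi * win_lo x)) * (exp (2 * x) / 4 + 1)"
  proof (intro mult_left_mono exp_even_parity_upper[where p = p])
    show "0 \<le> upper_factor (real T) x * (1 / sqrt (pi * win_lo x))"
      unfolding upper_factor_def using big lo win_lo_le_hi by (intro add_nonneg_nonneg mult_nonneg_nonneg) auto
  qed (use scale_pos in auto)
  also have "\<dots> = upper_factor (real T) x * upper_mass x" by (simp add: upper_mass_def)
  also have "sum (\<lambda>j. inv_hankel \<rho> T j j) ?O \<le> (\<Sum>j\<in>?O. (real T + 1) * exp_even_term x j)"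
  proof (rule sum_mono)
    fix j assume "j \<in> ?O"
    have "(\<Sum>n\<le>T. (hermite_weight n j)\<^sup>2) \<le> (\<Sum>n\<le>T. real T ^ j)"
      by (intro sum_mono order_trans[OF hermite_weight_sq_le_power] power_mono) auto
    then have "inv_hankel \<rho> T j j \<le> (real T + 1) * real T ^ j / (\<rho> ^ j * fact j)\<^sup>2"
      unfolding inv_hankel_diag_eq[OF rho] by (intro divide_right_mono) (simp_all add: add.commute)
    also have "\<dots> = (real T + 1) * (x ^ j / fact j)\<^sup>2"
      unfolding scaled_power[symmetric] by simp
    also have "\<dots> \<le> (real T + 1) * exp_even_term x j"
      unfolding power_div_fact_sq
      using mult_right_mono[OF central_ratio_le_1[of j] exp_even_term_nonneg[of x j]]
      by (intro mult_left_mono) auto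
    finally show "inv_hankel \<rho> T j j \<le> (real T + 1) * exp_even_term x j" .
  qed
  also have "\<dots> = (real T + 1) * sum (exp_even_term x) ?O" by (simp add: sum_distrib_left)
  also have "\<dots> \<le> (real T + 1) * chernoff_tail x (width x)"
    using scale_pos wd by (intro mult_left_mono exp_even_tail_upper) (auto simp: win_lo_def win_hi_def)
  finally show ?thesis by simp
qed

text \<open>Within a block the lower bound for squared entries is a product of a function of j and a
  function of k, so its double sum is the square of a single sum. The factor 2 counts the two
  blocks.\<close>

lemma inv_hankel_sq_sum_lower:
  assumes "lower_factor (real T) x \<ge> 0" "lower_mass x \<ge> 0"
  shows "2 * (lower_factor (real T) x * lower_mass x)\<^sup>2 \<le> (\<Sum>j\<le>T. \<Sum>k\<le>T. (inv_hankel \<rho> T j k)\<^sup>2)"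
proof -
  let ?V = "lower_factor (real T) x"
  let ?W = "\<lambda>p. {j. even (j + p) \<and> win_lo x \<le> real j \<and> real j \<le> win_hi x}"
  have "win_hi x \<le> real T"
  proof -
    have "(1 - width x) * real T \<le> 1 * real T" using wd by (intro mult_right_mono) auto
    then show ?thesis using big lo win_lo_le_hi by linarith
  qed
  then have WT: "?W p \<subseteq> {j. j \<le> T \<and> even (j + p)}" for p by auto
  have finT: "finite {j. j \<le> T \<and> even (j + p)}" for p by auto
  have fin: "finite (?W p)" for p by (rule finite_subset[OF WT finT])
  have mass: "lower_mass x \<le> (\<Sum>j\<in>?W p. (x ^ j / fact j)\<^sup>2)" for p :: nat
  proof -
    have "lower_mass x \<le> 1 / sqrt (pi * (win_hi x + 1 / 2)) * sum (exp_even_term x) (?W p)"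
      unfolding lower_mass_def
      by (intro mult_left_mono exp_even_parity_lower[where p = p] fin)
         (use scale_pos wd lo win_lo_le_hi in \<open>auto simp: win_lo_def win_hi_def\<close>)
    also have "\<dots> = (\<Sum>j\<in>?W p. 1 / sqrt (pi * (win_hi x + 1 / 2)) * exp_even_term x j)"
      by (rule sum_distrib_left)
    also have "\<dots> \<le> (\<Sum>j\<in>?W p. (x ^ j / fact j)\<^sup>2)"
    proof (rule sum_mono)
      fix j assume "j \<in> ?W p"
      then have "1 / sqrt (pi * (win_hi x + 1 / 2)) \<le> 1 / sqrt (pi * (real j + 1 / 2))"
        using lo win_lo_le_hi
        by (intro divide_left_mono real_sqrt_le_mono mult_left_mono mult_pos_pos) (auto intro: add_nonneg_pos)
      also have "\<dots> \<le> central_ratio j" by (rule central_ratio_lower)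
      finally show "1 / sqrt (pi * (win_hi x + 1 / 2)) * exp_even_term x j \<le> (x ^ j / fact j)\<^sup>2"
        unfolding power_div_fact_sq by (intro mult_right_mono exp_even_term_nonneg)
    qed
    finally show ?thesis .
  qed
  have entry: "?V\<^sup>2 * ((x ^ j / fact j)\<^sup>2 * (x ^ k / fact k)\<^sup>2) \<le> (inv_hankel \<rho> T j k)\<^sup>2"
    if "j \<in> ?W p" "k \<in> ?W p" for j k p
  proof -
    have jk: "even (j + k)" using that by auto
    define s where "s = (j + k) div 2"
    have s: "j + k = 2 * s" using jk by (auto simp: s_def)
    have "real T ^ s * ?V \<le> (\<Sum>n\<le>T. hermite_weight n j * hermite_weight n k)"
      unfolding lower_factor_def s_def using that
      by (intro hermite_weight_sum_lower[OF T wd _ _ _ _ jk big]) auto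
    then have "(real T ^ s * ?V)\<^sup>2 \<le> (\<Sum>n\<le>T. hermite_weight n j * hermite_weight n k)\<^sup>2"
      using assms by (intro power_mono) auto
    then have "(real T ^ s * ?V)\<^sup>2 / (\<rho> ^ j * fact j * (\<rho> ^ k * fact k))\<^sup>2
       \<le> (\<Sum>n\<le>T. hermite_weight n j * hermite_weight n k)\<^sup>2 / (\<rho> ^ j * fact j * (\<rho> ^ k * fact k))\<^sup>2"
      by (rule divide_right_mono) simp
    also have "\<dots> = (inv_hankel \<rho> T j k)\<^sup>2"
      unfolding inv_hankel_eq[OF rho jk] by (simp add: power_divide power_mult_distrib flip: power_mult)
    also have "(real T ^ s * ?V)\<^sup>2 / (\<rho> ^ j * fact j * (\<rho> ^ k * fact k))\<^sup>2
      = ?V\<^sup>2 * (real T ^ j / (\<rho> ^ j * fact j)\<^sup>2 * (real T ^ k / (\<rho> ^ k * fact k)\<^sup>2))"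
    proof -
      have "(real T ^ s)\<^sup>2 = real T ^ j * real T ^ k"
        unfolding power_add[symmetric] s by (simp add: mult.commute flip: power_mult)
      then show ?thesis by (simp add: power_mult_distrib)
    qed
    finally show ?thesis unfolding scaled_power .
  qed
  have block: "(?V * lower_mass x)\<^sup>2 \<le> (\<Sum>j | j \<le> T \<and> even (j + p). \<Sum>k\<le>T. (inv_hankel \<rho> T j k)\<^sup>2)" for p
  proof -
    have "(?V * lower_mass x)\<^sup>2 \<le> (?V * (\<Sum>j\<in>?W p. (x ^ j / fact j)\<^sup>2))\<^sup>2"
      using assms mass[of p] by (intro power_mono mult_left_mono) auto
    also have "\<dots> = ?V\<^sup>2 * ((\<Sum>j\<in>?W p. (x ^ j / fact j)\<^sup>2) * (\<Sum>k\<in>?W p. (x ^ k / fact k)\<^sup>2))"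
      unfolding power_mult_distrib[of ?V] by (simp only: power2_eq_square[of "sum _ _"])
    also have "\<dots> = (\<Sum>j\<in>?W p. \<Sum>k\<in>?W p. ?V\<^sup>2 * ((x ^ j / fact j)\<^sup>2 * (x ^ k / fact k)\<^sup>2))"
      unfolding sum_product by (simp only: sum_distrib_left)
    also have "\<dots> \<le> (\<Sum>j\<in>?W p. \<Sum>k\<in>?W p. (inv_hankel \<rho> T j k)\<^sup>2)"
      by (intro sum_mono entry)
    also have "\<dots> \<le> (\<Sum>j\<in>?W p. \<Sum>k\<le>T. (inv_hankel \<rho> T j k)\<^sup>2)"
      using WT by (intro sum_mono sum_mono2) auto
    also have "\<dots> \<le> (\<Sum>j | j \<le> T \<and> even (j + p). \<Sum>k\<le>T. (inv_hankel \<rho> T j k)\<^sup>2)"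
      by (intro sum_mono2 finT WT sum_nonneg) auto
    finally show ?thesis .
  qed
  show ?thesis
    unfolding sum_parity_split[of "\<lambda>j. \<Sum>k\<le>T. (inv_hankel \<rho> T j k)\<^sup>2"]
    using block[of 0] block[of 1] by linarith
qed

end

section \<open>The smallest eigenvalue\<close>

text \<open>The trace bounds give lw^2 / up \<le> 1 / lambda_min \<le> up, the factor 2 having
  cancelled. Divided by the main mass, the outer terms tend to g^2 / g and to g.\<close>

lemma lambda_min_inverse_limit:
  assumes rho: "\<rho> > 0"
  shows "(\<lambda>T. 1 / lambda_min \<rho> T / main_mass (sqrt (real T) / \<rho>)) \<longlonglongrightarrow> limit_factor \<rho>"
proof -
  define X where "X T = sqrt (real T) / \<rho>" for T :: nat
  define up where "up x = upper_factor (\<rho>\<^sup>2 * x\<^sup>2) x * upper_mass x + (\<rho>\<^sup>2 * x\<^sup>2 + 1) * chernoff_tail x (width x)" for x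
  define lw where "lw x = lower_factor (\<rho>\<^sup>2 * x\<^sup>2) x * lower_mass x" for x
  have g0: "limit_factor \<rho> > 0" using rho by (simp add: limit_factor_def)
  have X: "filterlim X at_top sequentially" unfolding X_def using rho by real_asymp
  have TX: "\<rho>\<^sup>2 * (X T)\<^sup>2 = real T" for T using rho by (simp add: X_def power_divide)
  have m0: "main_mass x > 0" if "x > 0" for x using that by (simp add: main_mass_def)
  have up_lim: "((\<lambda>x. up x / main_mass x) \<longlongrightarrow> limit_factor \<rho>) at_top"
  proof -
    have "((\<lambda>x. upper_factor (\<rho>\<^sup>2 * x\<^sup>2) x * (upper_mass x / main_mass x)
        + (\<rho>\<^sup>2 * x\<^sup>2 + 1) * chernoff_tail x (width x) / main_mass x) \<longlongrightarrow> limit_factor \<rho> * 1 + 0) at_top"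
      by (intro tendsto_intros upper_factor_limit upper_mass_limit chernoff_tail_limit rho)
    then show ?thesis by (simp add: up_def add_divide_distrib)
  qed
  have lw_lim: "((\<lambda>x. lw x / main_mass x) \<longlongrightarrow> limit_factor \<rho>) at_top"
  proof -
    have "((\<lambda>x. lower_factor (\<rho>\<^sup>2 * x\<^sup>2) x * (lower_mass x / main_mass x)) \<longlongrightarrow> limit_factor \<rho> * 1) at_top"
      by (intro tendsto_intros lower_factor_limit lower_mass_limit rho)
    then show ?thesis by (simp add: lw_def)
  qed
  \<comment> \<open>The lower bounds may be squared only once they are nonnegative; this holds
    eventually because their normalized limits are positive.\<close>
  have "eventually (\<lambda>x. lower_factor (\<rho>\<^sup>2 * x\<^sup>2) x > 0) at_top"
    by (rule order_tendstoD(1)[OF lower_factor_limit[OF rho] g0])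
  moreover have "eventually (\<lambda>x. lower_mass x / main_mass x > 0) at_top"
    by (rule order_tendstoD(1)[OF lower_mass_limit]) simp
  moreover have "eventually (\<lambda>x. up x / main_mass x > 0) at_top"
    by (rule order_tendstoD(1)[OF up_lim g0])
  ultimately have "eventually (\<lambda>x. x > 0 \<and> 0 < width x \<and> width x < 1 \<and> 1 \<le> win_lo x
     \<and> 2 * win_hi x \<le> (1 - width x) * (\<rho>\<^sup>2 * x\<^sup>2) \<and> lower_factor (\<rho>\<^sup>2 * x\<^sup>2) x \<ge> 0 \<and> lower_mass x \<ge> 0 \<and> up x > 0) at_top"
    using window_eventually[OF rho]
  proof eventually_elim
    case (elim x)
    then show ?case using m0[of x] by (auto simp: zero_less_divide_iff)
  qed
  from eventually_compose_filterlim[OF this X]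
  have ev: "eventually (\<lambda>T. (lw (X T) / main_mass (X T))\<^sup>2 / (up (X T) / main_mass (X T)) \<le> 1 / lambda_min \<rho> T / main_mass (X T)
      \<and> 1 / lambda_min \<rho> T / main_mass (X T) \<le> up (X T) / main_mass (X T)) sequentially"
    using eventually_gt_at_top[of 0]
  proof eventually_elim
    case (elim T)
    let ?x = "X T"
    have c: "0 < width ?x" "width ?x < 1" "1 \<le> win_lo ?x" "2 * win_hi ?x \<le> (1 - width ?x) * real T"
      "lower_factor (real T) ?x \<ge> 0" "lower_mass ?x \<ge> 0" "up ?x > 0" "?x > 0"
      using elim by (auto simp: TX)
    interpret gauss_hankel \<rho> T by standard (rule rho)
    have up: "parity_trace \<rho> T p \<le> up ?x" for p
      using parity_trace_upper[OF rho elim(2) X_def c(1-4)] by (simp add: up_def TX)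
    have "1 / lambda_min \<rho> T \<le> up ?x"
      using lambda_min_bounds(2) up[of 0] up[of 1] by linarith
    then have 1: "1 / lambda_min \<rho> T / main_mass ?x \<le> up ?x / main_mass ?x"
      using m0[OF c(8)] by (intro divide_right_mono) auto
    have "2 * (lw ?x)\<^sup>2 \<le> (\<Sum>j\<le>T. \<Sum>k\<le>T. (inv_hankel \<rho> T j k)\<^sup>2)"
      using inv_hankel_sq_sum_lower[OF rho elim(2) X_def c(1-6)] by (simp add: lw_def TX)
    also have "\<dots> \<le> 1 / lambda_min \<rho> T * (parity_trace \<rho> T 0 + parity_trace \<rho> T 1)"
      by (rule lambda_min_bounds(3))
    also have "\<dots> \<le> 1 / lambda_min \<rho> T * (2 * up ?x)"
      using lambda_min_bounds(1) up[of 0] up[of 1] by (intro mult_left_mono) auto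
    finally have "(lw ?x)\<^sup>2 / up ?x \<le> 1 / lambda_min \<rho> T"
      using c(7) by (simp add: pos_divide_le_eq)
    then have "(lw ?x)\<^sup>2 / up ?x / main_mass ?x \<le> 1 / lambda_min \<rho> T / main_mass ?x"
      using m0[OF c(8)] by (intro divide_right_mono) auto
    moreover have "(lw ?x)\<^sup>2 / up ?x / main_mass ?x = (lw ?x / main_mass ?x)\<^sup>2 / (up ?x / main_mass ?x)"
      using m0[OF c(8)] by (simp add: power2_eq_square)
    ultimately show ?case using 1 by simp
  qed
  have "(\<lambda>T. (lw (X T) / main_mass (X T))\<^sup>2 / (up (X T) / main_mass (X T)))
     \<longlonglongrightarrow> (limit_factor \<rho>)\<^sup>2 / limit_factor \<rho>"
    using g0 by (intro tendsto_intros filterlim_compose[OF lw_lim X] filterlim_compose[OF up_lim X]) auto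
  then have lwl: "(\<lambda>T. (lw (X T) / main_mass (X T))\<^sup>2 / (up (X T) / main_mass (X T))) \<longlonglongrightarrow> limit_factor \<rho>"
    using g0 by (simp add: power2_eq_square)
  show ?thesis unfolding X_def[symmetric]
    by (rule tendsto_sandwich[OF _ _ lwl filterlim_compose[OF up_lim X]])
       (use ev in \<open>auto elim: eventually_mono\<close>)
qed

lemma lambda_min_asymptotics:
  assumes rho: "\<rho> > 0"
  shows "(\<lambda>T. lambda_min \<rho> T /
           (2 powr (5/2) * pi * real T powr (1/4) / \<rho> powr (3/2)
             * exp (1 / (2 * \<rho>\<^sup>2) - 2 * sqrt (real T) / \<rho>))) \<longlonglongrightarrow> 1"
proof -
  have g0: "limit_factor \<rho> > 0" using rho by (simp add: limit_factor_def)
  have "(\<lambda>T. limit_factor \<rho> / (1 / lambda_min \<rho> T / main_mass (sqrt (real T) / \<rho>))) \<longlonglongrightarrow> limit_factor \<rho> / limit_factor \<rho>"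
    using g0 by (intro tendsto_intros lambda_min_inverse_limit rho) auto
  then have lim: "(\<lambda>T. limit_factor \<rho> / (1 / lambda_min \<rho> T / main_mass (sqrt (real T) / \<rho>))) \<longlonglongrightarrow> 1"
    using g0 by simp
  have "eventually (\<lambda>T. limit_factor \<rho> / (1 / lambda_min \<rho> T / main_mass (sqrt (real T) / \<rho>))
     = lambda_min \<rho> T / (2 powr (5/2) * pi * real T powr (1/4) / \<rho> powr (3/2)
             * exp (1 / (2 * \<rho>\<^sup>2) - 2 * sqrt (real T) / \<rho>))) sequentially"
    using eventually_gt_at_top[of 0]
  proof eventually_elim
    case (elim T)
    \<comment> \<open>With q the fourth root of T and h the square root of \<rho>, all fractional
      powers become integral ones.\<close>
    define q where "q = real T powr (1 / 4)"
    define h where "h = sqrt \<rho>"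
    have q: "q > 0" "sqrt (real T) = q\<^sup>2" "sqrt (sqrt (real T)) = q"
      using elim by (simp_all add: q_def powr_half_sqrt[symmetric] powr_powr powr_power)
    have h: "h > 0" "\<rho> = h\<^sup>2" using rho by (simp_all add: h_def)
    have r32: "\<rho> powr (3 / 2) = h ^ 3"
      using rho by (simp add: h_def powr_half_sqrt[symmetric] powr_power)
    have two: "2 powr (5 / 2) = 4 * sqrt 2"
    proof -
      have "(2::real) powr (5 / 2) = 2 powr (2 + 1 / 2)" by simp
      also have "\<dots> = 4 * sqrt 2" unfolding powr_add by (simp add: powr_half_sqrt)
      finally show ?thesis .
    qed
    have spi: "sqrt (pi * (sqrt (real T) / \<rho>)) = sqrt pi * q / h"
      by (simp add: real_sqrt_mult real_sqrt_divide q(3) h_def)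
    have "limit_factor \<rho> * main_mass (sqrt (real T) / \<rho>)
      = (sqrt 2 / sqrt pi) * (h\<^sup>2 / 2) * exp (- 1 / (2 * \<rho>\<^sup>2)) * (exp (2 * sqrt (real T) / \<rho>) / (4 * (sqrt pi * q / h)))"
      unfolding limit_factor_def main_mass_def spi by (simp add: real_sqrt_divide h(2)[symmetric])
    also have "\<dots> = (sqrt 2 * h ^ 3 / (8 * pi * q)) * (exp (- 1 / (2 * \<rho>\<^sup>2)) * exp (2 * sqrt (real T) / \<rho>))"
      using h(1) q(1) by (simp add: power2_eq_square power3_eq_cube field_simps)
    also have "exp (- 1 / (2 * \<rho>\<^sup>2)) * exp (2 * sqrt (real T) / \<rho>) = inverse (exp (1 / (2 * \<rho>\<^sup>2) - 2 * sqrt (real T) / \<rho>))"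
      by (simp add: exp_add[symmetric] exp_minus[symmetric])
    also have "sqrt 2 * h ^ 3 / (8 * pi * q) = inverse (4 * sqrt 2 * pi * q / h ^ 3)"
      using h(1) q(1) by (simp add: field_simps)
    also have "\<dots> * inverse (exp (1 / (2 * \<rho>\<^sup>2) - 2 * sqrt (real T) / \<rho>))
       = 1 / (4 * sqrt 2 * pi * q / h ^ 3 * exp (1 / (2 * \<rho>\<^sup>2) - 2 * sqrt (real T) / \<rho>))"
      by (subst inverse_mult_distrib[symmetric]) (rule inverse_eq_divide)
    finally have key: "limit_factor \<rho> * main_mass (sqrt (real T) / \<rho>)
       = 1 / (4 * sqrt 2 * pi * q / h ^ 3 * exp (1 / (2 * \<rho>\<^sup>2) - 2 * sqrt (real T) / \<rho>))" .
    have "limit_factor \<rho> / (1 / lambda_min \<rho> T / main_mass (sqrt (real T) / \<rho>))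
        = lambda_min \<rho> T * (limit_factor \<rho> * main_mass (sqrt (real T) / \<rho>))" by simp
    then show ?case unfolding key two r32 q_def[symmetric] by simp
  qed
  then show ?thesis using lim by (rule Lim_transform_eventually[rotated])
qed

section \<open>The largest eigenvalue\<close>

text \<open>Stirling's formula with an unidentified constant l, which is enough because only a
  quotient of two such ratios is taken later. The logarithm a(n) converges since its decrements c(n)
  are O(1 / n^2).\<close>

lemma stirling_ratio_convergent:
  obtains l :: real where "l > 0" "(\<lambda>n. fact n / (sqrt (real n) * (real n / exp 1) ^ n)) \<longlonglongrightarrow> l"
proof -
  define a where "a n = ln (fact n) - (real n + 1 / 2) * ln (real n) + real n" for n :: nat
  define c where "c n = (real n + 1 / 2) * ln (1 + 1 / real n) - 1" for n :: nat
  have "(\<lambda>n. (real n + 1 / 2) * ln (1 + 1 / real n) - 1) \<in> O(\<lambda>n. 1 / real n ^ 2)" by real_asymp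
  then have "c \<in> O(\<lambda>n. 1 / real n ^ 2)" by (simp only: c_def[abs_def])
  moreover have "summable (\<lambda>n. norm (1 / real n ^ 2))"
    using inverse_power_summable[of 2, where ?'a = real] by (simp add: inverse_eq_divide)
  ultimately have "summable c" by (rule summable_comparison_test_bigo[rotated])
  \<comment> \<open>Shifted by one: at n = 0 both 1 / n and ln n are default values.\<close>
  then have "summable (\<lambda>n. c (n + 1))" by (rule summable_ignore_initial_segment)
  then have "convergent (\<lambda>n. \<Sum>k<n. c (k + 1))" by (simp only: summable_iff_convergent)
  then obtain S where S: "(\<lambda>n. \<Sum>k<n. c (k + 1)) \<longlonglongrightarrow> S" by (auto simp: convergent_def)
  have step: "a (n + 1) - a (n + 2) = c (n + 1)" for n
  proof -
    have 1: "ln (fact (n + 2)) = ln (real (n + 2)) + ln (fact (n + 1))"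
      using ln_mult_pos[of "real (n + 2)" "fact (n + 1)"] by (simp add: add.commute)
    have 2: "ln (1 + 1 / real (n + 1)) = ln (real (n + 2)) - ln (real (n + 1))"
    proof -
      have "1 + 1 / real (n + 1) = real (n + 2) / real (n + 1)" by (simp add: field_simps)
      then show ?thesis by (simp only: ln_div) simp
    qed
    show ?thesis unfolding a_def c_def 1 2 by (simp add: algebra_simps)
  qed
  have eq: "a (n + 1) = a 1 - (\<Sum>k<n. c (k + 1))" for n
  proof (induction n)
    case (Suc n)
    then show ?case using step[of n] by simp
  qed simp
  have "(\<lambda>n. a 1 - (\<Sum>k<n. c (k + 1))) \<longlonglongrightarrow> a 1 - S" by (intro tendsto_intros S)
  then have "(\<lambda>n. a (Suc n)) \<longlonglongrightarrow> a 1 - S" by (simp only: eq[symmetric] Suc_eq_plus1)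
  then have "a \<longlonglongrightarrow> a 1 - S" by (rule LIMSEQ_imp_Suc)
  then have "(\<lambda>n. exp (a n)) \<longlonglongrightarrow> exp (a 1 - S)" by (intro tendsto_intros)
  moreover have "eventually (\<lambda>n. exp (a n) = fact n / (sqrt (real n) * (real n / exp 1) ^ n)) sequentially"
    using eventually_gt_at_top[of 0]
  proof eventually_elim
    case (elim n)
    have "a n = ln (fact n) - (real n * ln (real n) + ln (real n) / 2 - real n)"
      by (simp add: a_def algebra_simps)
    also have "exp \<dots> = fact n / exp (real n * ln (real n) + ln (real n) / 2 - real n)"
      by (simp add: exp_diff)
    also have "exp (real n * ln (real n) + ln (real n) / 2 - real n) = sqrt (real n) * (real n / exp 1) ^ n"
    proof -
      have "exp (ln (real n) / 2) = sqrt (real n)"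
        using elim by (simp add: ln_sqrt[symmetric])
      moreover have "exp (real n * ln (real n)) = real n ^ n" using elim by (simp add: exp_of_nat_mult)
      moreover have "exp (real n) = exp 1 ^ n" by (simp flip: exp_of_nat_mult)
      ultimately show ?thesis by (simp add: exp_diff exp_add power_divide)
    qed
    finally show ?case .
  qed
  ultimately have "(\<lambda>n. fact n / (sqrt (real n) * (real n / exp 1) ^ n)) \<longlonglongrightarrow> exp (a 1 - S)"
    by (rule Lim_transform_eventually)
  then show ?thesis by (rule that[OF exp_gt_zero])
qed

lemma gauss_moment_asymptotics:
  assumes rho: "\<rho> > 0"
  shows "(\<lambda>T. gauss_moment \<rho> (2 * T) / (sqrt 2 * (2 * \<rho>\<^sup>2 * real T / exp 1) ^ T)) \<longlonglongrightarrow> 1"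
proof -
  obtain l :: real where l: "l > 0" "(\<lambda>n. fact n / (sqrt (real n) * (real n / exp 1) ^ n)) \<longlonglongrightarrow> l"
    by (rule stirling_ratio_convergent)
  define s where "s n = fact n / (sqrt (real n) * (real n / exp 1) ^ n)" for n :: nat
  have s: "s \<longlonglongrightarrow> l" unfolding s_def[abs_def] by (rule l(2))
  \<comment> \<open>The moment contains (2T)! / T!, so l cancels; sqrt(2T) / sqrt T leaves the
    factor sqrt 2.\<close>
  have "(\<lambda>T. s (2 * T) / s T) \<longlonglongrightarrow> l / l"
    using l(1) by (intro tendsto_divide s filterlim_compose[OF s]) (real_asymp, simp)
  then have "(\<lambda>T. s (2 * T) / s T) \<longlonglongrightarrow> 1" using l(1) by simp
  moreover have "eventually (\<lambda>T. s (2 * T) / s T = gauss_moment \<rho> (2 * T) / (sqrt 2 * (2 * \<rho>\<^sup>2 * real T / exp 1) ^ T)) sequentially"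
    using eventually_gt_at_top[of 0]
  proof eventually_elim
    case (elim T)
    define t where "t = real T"
    have t: "t > 0" using elim by (simp add: t_def)
    have 1: "s (2 * T) = fact (2 * T) / (sqrt 2 * sqrt t * ((2 * t / exp 1) ^ T * (2 ^ T * (t / exp 1) ^ T)))"
      unfolding s_def by (simp add: t_def[symmetric] real_sqrt_mult mult_2[of T] power_add power_divide power_mult_distrib)
    have 2: "s T = fact T / (sqrt t * (t / exp 1) ^ T)" by (simp add: s_def t_def)
    have 3: "gauss_moment \<rho> (2 * T) / (sqrt 2 * (2 * \<rho>\<^sup>2 * t / exp 1) ^ T)
       = fact (2 * T) / (2 ^ T * fact T) / (sqrt 2 * (2 * t / exp 1) ^ T)"
    proof -
      have "(2 * \<rho>\<^sup>2 * t / exp 1) ^ T = \<rho> ^ (2 * T) * (2 * t / exp 1) ^ T"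
        unfolding power_mult power_mult_distrib[symmetric] by (simp add: mult_ac)
      then show ?thesis using rho by (simp add: gauss_moment_even[OF rho])
    qed
    have "s (2 * T) / s T = fact (2 * T) / (2 ^ T * fact T) / (sqrt 2 * (2 * t / exp 1) ^ T)"
      unfolding 1 2 using t by (simp add: divide_simps)
    then show ?case using 3 by (simp add: t_def)
  qed
  ultimately show ?thesis by (rule Lim_transform_eventually)
qed

text \<open>The normalized sum obeys R(T + 1) = 1 + R(T) / d(T) with d(T) tending to infinity, so
  boundedness of R already gives the limit 1.\<close>

lemma gauss_moment_sum_ratio:
  assumes rho: "\<rho> > 0"
  shows "(\<lambda>T. (\<Sum>i\<le>T. gauss_moment \<rho> (2 * i)) / gauss_moment \<rho> (2 * T)) \<longlonglongrightarrow> 1"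
proof -
  define R where "R T = (\<Sum>i\<le>T. gauss_moment \<rho> (2 * i)) / gauss_moment \<rho> (2 * T)" for T
  define d where "d T = \<rho>\<^sup>2 * real (Suc (2 * T))" for T
  have mpos: "gauss_moment \<rho> (2 * i) > 0" for i using rho by (simp add: gauss_moment_even)
  have d0: "d T > 0" for T using rho by (simp add: d_def add_pos_nonneg)
  have rec: "R (Suc T) = 1 + R T / d T" for T
  proof -
    have "gauss_moment \<rho> (2 * Suc T) = d T * gauss_moment \<rho> (2 * T)"
      using gauss_moment_rec[OF rho, of "2 * T"] by (simp add: d_def)
    then show ?thesis
      using mpos[of T] d0[of T] unfolding R_def by (simp add: add_divide_distrib mult.commute)
  qed
  have R0: "R T \<ge> 0" for T unfolding R_def by (intro divide_nonneg_nonneg sum_nonneg less_imp_le[OF mpos])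
  have "eventually (\<lambda>T. d T \<ge> 2) sequentially" unfolding d_def using rho by real_asymp
  then obtain N where N: "\<And>T. T \<ge> N \<Longrightarrow> d T \<ge> 2" by (auto simp: eventually_at_top_linorder)
  \<comment> \<open>M \<ge> 2 gives 1 + M / 2 \<le> M, so the bound M is preserved as soon as d(T)
    \<ge> 2.\<close>
  define M where "M = max 2 (R N)"
  have bound: "R T \<le> M" if "T \<ge> N" for T
    using that
  proof (induction T rule: dec_induct)
    case (step T)
    have "R T / d T \<le> M / 2" using step N[of T] R0[of T] by (intro frac_le) (auto simp: M_def)
    then have "R (Suc T) \<le> 1 + M / 2" by (simp add: rec)
    also have "\<dots> \<le> M" by (simp add: M_def)
    finally show ?case .
  qed (simp add: M_def)
  have "(\<lambda>T. R T / d T) \<longlonglongrightarrow> 0"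
  proof (rule tendsto_sandwich)
    show "eventually (\<lambda>T. 0 \<le> R T / d T) sequentially" using R0 d0 by (simp add: less_imp_le)
    show "eventually (\<lambda>T. R T / d T \<le> M / d T) sequentially"
      using eventually_ge_at_top[of N] by eventually_elim (auto intro!: divide_right_mono bound less_imp_le[OF d0])
    show "(\<lambda>T. M / d T) \<longlonglongrightarrow> 0" unfolding d_def using rho by real_asymp
  qed simp
  then have "(\<lambda>T. 1 + R T / d T) \<longlonglongrightarrow> 1 + 0" by (intro tendsto_intros)
  then have "(\<lambda>T. R (Suc T)) \<longlonglongrightarrow> 1" by (simp add: rec)
  then show ?thesis unfolding R_def[symmetric] by (rule LIMSEQ_imp_Suc)
qed

text \<open>The quotient of the largest eigenvalue and the trace lies between the square of m_(2T) /
  tr B and 1.\<close>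

lemma lambda_max_sum_limit:
  assumes rho: "\<rho> > 0"
  shows "(\<lambda>T. lambda_max \<rho> T / lambda_sum \<rho> T) \<longlonglongrightarrow> 1"
    and "(\<lambda>T. lambda_max \<rho> T / gauss_moment \<rho> (2 * T)) \<longlonglongrightarrow> 1"
proof -
  have mpos: "gauss_moment \<rho> (2 * i) > 0" for i using rho by (simp add: gauss_moment_even)
  have sum: "lambda_sum \<rho> T = (\<Sum>i\<le>T. gauss_moment \<rho> (2 * i))" for T
    using gauss_hankel.lambda_sum_eq[of \<rho> T] rho by (simp add: gauss_hankel_def)
  have spos: "lambda_sum \<rho> T > 0" for T unfolding sum by (intro sum_pos mpos) auto
  have sm: "(\<lambda>T. lambda_sum \<rho> T / gauss_moment \<rho> (2 * T)) \<longlonglongrightarrow> 1"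
    unfolding sum by (rule gauss_moment_sum_ratio[OF rho])
  have "(\<lambda>T. (1 / (lambda_sum \<rho> T / gauss_moment \<rho> (2 * T)))\<^sup>2) \<longlonglongrightarrow> (1 / 1)\<^sup>2"
    by (intro tendsto_intros sm) auto
  then have lo: "(\<lambda>T. (1 / (lambda_sum \<rho> T / gauss_moment \<rho> (2 * T)))\<^sup>2) \<longlonglongrightarrow> 1" by simp
  show 1: "(\<lambda>T. lambda_max \<rho> T / lambda_sum \<rho> T) \<longlonglongrightarrow> 1"
  proof (rule tendsto_sandwich[OF _ _ lo tendsto_const])
    show "eventually (\<lambda>T. (1 / (lambda_sum \<rho> T / gauss_moment \<rho> (2 * T)))\<^sup>2 \<le> lambda_max \<rho> T / lambda_sum \<rho> T) sequentially"
    proof (rule always_eventually, rule allI)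
      fix T
      interpret gauss_hankel \<rho> T by standard (rule rho)
      show "(1 / (lambda_sum \<rho> T / gauss_moment \<rho> (2 * T)))\<^sup>2 \<le> lambda_max \<rho> T / lambda_sum \<rho> T"
        using lambda_max_bounds(2) spos[of T] by (simp add: power_divide power2_eq_square divide_simps)
    qed
    show "eventually (\<lambda>T. lambda_max \<rho> T / lambda_sum \<rho> T \<le> 1) sequentially"
    proof (rule always_eventually, rule allI)
      fix T
      interpret gauss_hankel \<rho> T by standard (rule rho)
      show "lambda_max \<rho> T / lambda_sum \<rho> T \<le> 1"
        using lambda_max_bounds(1) spos[of T] by simp
    qed
  qed
  have lim: "(\<lambda>T. lambda_max \<rho> T / lambda_sum \<rho> T * (lambda_sum \<rho> T / gauss_moment \<rho> (2 * T))) \<longlonglongrightarrow> 1 * 1"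
    by (intro tendsto_mult 1 sm)
  have eq: "lambda_max \<rho> T / lambda_sum \<rho> T * (lambda_sum \<rho> T / gauss_moment \<rho> (2 * T))
     = lambda_max \<rho> T / gauss_moment \<rho> (2 * T)" for T
    using spos[of T] by simp
  show "(\<lambda>T. lambda_max \<rho> T / gauss_moment \<rho> (2 * T)) \<longlonglongrightarrow> 1"
    using lim by (simp only: eq mult_1_left)
qed

theorem mainTheorem4:
  fixes \<rho> :: real
  assumes "\<rho> > 0"
  shows "(\<lambda>T. lambda_max \<rho> T / lambda_sum \<rho> T) \<longlonglongrightarrow> 1
    \<and> (\<lambda>T. lambda_max \<rho> T / (sqrt 2 * (2 * \<rho>\<^sup>2 * real T / exp 1) ^ T)) \<longlonglongrightarrow> 1
    \<and> (\<lambda>T. lambda_min \<rho> T /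
           (2 powr (5/2) * pi * real T powr (1/4) / \<rho> powr (3/2)
             * exp (1 / (2 * \<rho>\<^sup>2) - 2 * sqrt (real T) / \<rho>))) \<longlonglongrightarrow> 1"
proof (intro conjI lambda_max_sum_limit(1) lambda_min_asymptotics assms)
  have mpos: "gauss_moment \<rho> (2 * T) > 0" for T using assms by (simp add: gauss_moment_even)
  have lim: "(\<lambda>T. lambda_max \<rho> T / gauss_moment \<rho> (2 * T) * (gauss_moment \<rho> (2 * T) / (sqrt 2 * (2 * \<rho>\<^sup>2 * real T / exp 1) ^ T))) \<longlonglongrightarrow> 1 * 1"
    by (intro tendsto_mult lambda_max_sum_limit(2) gauss_moment_asymptotics assms)
  have eq: "lambda_max \<rho> T / gauss_moment \<rho> (2 * T) * (gauss_moment \<rho> (2 * T) / (sqrt 2 * (2 * \<rho>\<^sup>2 * real T / exp 1) ^ T))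
    = lambda_max \<rho> T / (sqrt 2 * (2 * \<rho>\<^sup>2 * real T / exp 1) ^ T)" for T
    using mpos[of T] by simp
  show "(\<lambda>T. lambda_max \<rho> T / (sqrt 2 * (2 * \<rho>\<^sup>2 * real T / exp 1) ^ T)) \<longlonglongrightarrow> 1"
    using lim by (simp only: eq mult_1_left)
qed

end
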